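(* Let $G$ be a group and let $\mathcal{E}$ denote the (right) finitary coarse structure on $G$. Then the following statements are equivalent: (i) there exists a linear order $\leq$ on $G$ such that $\mathcal{E}$ is interval with respect to $\leq$; (ii) there exists a linear order $\leq$ on $G$ compatible with $\mathcal{E}$; (iii) $G$ admits a 2-selector.
   Context: A coarse structure on a set $X$ is a family $\mathcal{E}$ of subsets of $X\times X$ (called entourages) such that: each $E\in\mathcal{E}$ contains the diagonal $\triangle_X=\{(x,x):x\in X\}$; if $E,E'\in\mathcal{E}$ then $E\circ E'=\{(x,y):\exists z\ ((x,z)\in E,\ (z,y)\in E')\}\in\mathcal{E}$ and $E^{-1}=\{(y,x):(x,y)\in E\}\in\mathcal{E}$; and if $E\in\mathcal{E}$ and $\triangle_X\subseteq E'\subseteq E$ then $E'\in\mathcal{E}$. The pair $(X,\mathcal{E})$ is a coarse space. For $x\in X$, $Y\subseteq X$, $E\in\mathcal{E}$ put $E[x]=\{y\in X:(x,y)\in E\}$ and $E[Y]=\bigcup_{y\in Y}E[y]$. A subfamily $\mathcal{E}'\subseteq\mathcal{E}$ is a base of $\mathcal{E}$ if each $E\in\mathcal{E}$ is contained in some $E'\in\mathcal{E}'$. A subset $Y\subseteq X$ inherits the subspace coarse structure $\{E\cap(Y\times Y):E\in\mathcal{E}\}$. The (right) finitary coarse structure of a group $G$ with identity $e$ is the coarse structure with base $\{\{(x,y):x\in Fy\}: F\subseteq G \text{ finite},\ e\in F\}$. A linear order $\leq$ on $X$ is compatible with the coarse structure $\mathcal{E}$ if for every $E\in\mathcal{E}$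 there exists $F\in\mathcal{E}$ such that $E\subseteq F$ and, for all distinct $x,y\in X$ with $y\in X\setminus F[x]$: if $x<y$ then $x'<y$ for each $x'\in E[x]$, and if $y<x$ then $y<x'$ for each $x'\in E[x]$. Given a linear order $\leq$ on $X$, an entourage $E\in\mathcal{E}$ is interval (with respect to $\leq$) if for each $x\in X$ there exist $a_x,b_x\in X$ such that $a_x\leq x\leq b_x$ and $E[x]=[a_x,b_x]$. The coarse structure $\mathcal{E}$ is interval with respect to $\leq$ if it has a base consisting of interval entourages. A map $f:X\to X'$ between coarse spaces $(X,\mathcal{E})$, $(X',\mathcal{E}')$ is macro-uniform if for every $E\in\mathcal{E}$ there is $E'\in\mathcal{E}'$ such that $f(E[x])\subseteq E'[f(x)]$ for each $x\in X$. The set $\exp X$ of all non-empty subsets of $X$ is endowed with the coarse structure $\exp\mathcal{E}$ with base $\{\exp E:E\in\mathcal{E}\}$, where $(A,B)\in\exp E$ iff $A\subseteq E[B]$ and $B\subseteq E[A]$. A 2-selector of $(X,\mathcal{E})$ is a macro-uniform map $f:[X]^2\to X$ with $f(A)\in A$ for each $A\in[X]^2$, where $[X]^2$ is the set of two-element subsets of $X$ with the subspace coarse structure from $\exp X$ (if $[X]^2=\emptyset$, the empty map counts as a 2-selector). *)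

theory Defs
  imports "HOL-Algebra.Coset"
begin

text \<open>
  Coarse structures live on an explicit carrier set \<open>X\<close>; an entourage is a relation
  \<open>E \<subseteq> X \<times> X\<close>, and \<open>E[x]\<close>, \<open>E[Y]\<close> are the library images \<open>E `` {x}\<close>, \<open>E `` Y\<close>.
  The library's \<open>E O E'\<close> composes in the order \<open>(x,z) \<in> E\<close>, \<open>(z,y) \<in> E'\<close>.
\<close>

definition coarse_structure :: "'a set \<Rightarrow> 'a rel set \<Rightarrow> bool" where
  "coarse_structure X \<E> \<longleftrightarrow>
     (\<forall>E\<in>\<E>. E \<subseteq> X \<times> X \<and> Id_on X \<subseteq> E) \<and>
     (\<forall>E\<in>\<E>. \<forall>E'\<in>\<E>. E O E' \<in> \<E>) \<and>
     (\<forall>E\<in>\<E>. E\<inverse> \<in> \<E>) \<and>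
     (\<forall>E\<in>\<E>. \<forall>E'. Id_on X \<subseteq> E' \<and> E' \<subseteq> E \<longrightarrow> E' \<in> \<E>)"

definition coarse_base :: "'a rel set \<Rightarrow> 'a rel set \<Rightarrow> bool" where
  "coarse_base \<B> \<E> \<longleftrightarrow> \<B> \<subseteq> \<E> \<and> (\<forall>E\<in>\<E>. \<exists>B\<in>\<B>. E \<subseteq> B)"

definition generated_coarse :: "'a set \<Rightarrow> 'a rel set \<Rightarrow> 'a rel set" where
  "generated_coarse X \<B> = {E. Id_on X \<subseteq> E \<and> (\<exists>B\<in>\<B>. E \<subseteq> B)}"

definition subspace_coarse :: "'a set \<Rightarrow> 'a rel set \<Rightarrow> 'a rel set" where
  "subspace_coarse Y \<E> = {E \<inter> (Y \<times> Y) |E. E \<in> \<E>}"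

definition finitary_base :: "('a, 'b) monoid_scheme \<Rightarrow> 'a rel set" where
  "finitary_base G =
     {{(x, y). y \<in> carrier G \<and> x \<in> F #>\<^bsub>G\<^esub> y} |F. F \<subseteq> carrier G \<and> finite F \<and> \<one>\<^bsub>G\<^esub> \<in> F}"

definition finitary_coarse :: "('a, 'b) monoid_scheme \<Rightarrow> 'a rel set" where
  "finitary_coarse G = generated_coarse (carrier G) (finitary_base G)"

text \<open>
  A linear order on \<open>X\<close> is a relation \<open>r\<close> with \<open>linear_order_on X r\<close>, where \<open>(x, y) \<in> r\<close>
  means \<open>x \<le> y\<close>; the strict order is \<open>r - Id\<close>.
\<close>

definition compatible_order :: "'a set \<Rightarrow> 'a rel set \<Rightarrow> 'a rel \<Rightarrow> bool" where
  "compatible_order X \<E> r \<longleftrightarrow>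
     (\<forall>E\<in>\<E>. \<exists>F\<in>\<E>. E \<subseteq> F \<and>
        (\<forall>x\<in>X. \<forall>y\<in>X - F `` {x}. x \<noteq> y \<longrightarrow>
           ((x, y) \<in> r - Id \<longrightarrow> (\<forall>x'\<in>E `` {x}. (x', y) \<in> r - Id)) \<and>
           ((y, x) \<in> r - Id \<longrightarrow> (\<forall>x'\<in>E `` {x}. (y, x') \<in> r - Id))))"

definition interval_entourage :: "'a set \<Rightarrow> 'a rel \<Rightarrow> 'a rel \<Rightarrow> bool" where
  "interval_entourage X r E \<longleftrightarrow>
     (\<forall>x\<in>X. \<exists>a\<in>X. \<exists>b\<in>X. (a, x) \<in> r \<and> (x, b) \<in> r \<and>
        E `` {x} = {z\<in>X. (a, z) \<in> r \<and> (z, b) \<in> r})"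

definition interval_coarse :: "'a set \<Rightarrow> 'a rel set \<Rightarrow> 'a rel \<Rightarrow> bool" where
  "interval_coarse X \<E> r \<longleftrightarrow>
     (\<exists>\<B>. coarse_base \<B> \<E> \<and> (\<forall>B\<in>\<B>. interval_entourage X r B))"

definition macro_uniform ::
  "'a set \<Rightarrow> 'a rel set \<Rightarrow> 'b set \<Rightarrow> 'b rel set \<Rightarrow> ('a \<Rightarrow> 'b) \<Rightarrow> bool" where
  "macro_uniform X \<E> X' \<E>' f \<longleftrightarrow>
     f ` X \<subseteq> X' \<and> (\<forall>E\<in>\<E>. \<exists>E'\<in>\<E>'. \<forall>x\<in>X. f ` (E `` {x}) \<subseteq> E' `` {f x})"

definition exp_space :: "'a set \<Rightarrow> 'a set set" where
  "exp_space X = Pow X - {{}}"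

definition exp_entourage :: "'a set \<Rightarrow> 'a rel \<Rightarrow> 'a set rel" where
  "exp_entourage X E =
     {(A, B). A \<in> exp_space X \<and> B \<in> exp_space X \<and> A \<subseteq> E `` B \<and> B \<subseteq> E `` A}"

definition exp_coarse :: "'a set \<Rightarrow> 'a rel set \<Rightarrow> 'a set rel set" where
  "exp_coarse X \<E> = generated_coarse (exp_space X) (exp_entourage X ` \<E>)"

definition two_subsets :: "'a set \<Rightarrow> 'a set set" where
  "two_subsets X = {A. A \<subseteq> X \<and> card A = 2}"

text \<open>Only the values of \<open>f\<close> on \<open>two_subsets X\<close> matter.\<close>

definition two_selector :: "'a set \<Rightarrow> 'a rel set \<Rightarrow> ('a set \<Rightarrow> 'a) \<Rightarrow> bool" where
  "two_selector X \<E> f \<longleftrightarrow>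
     macro_uniform (two_subsets X) (subspace_coarse (two_subsets X) (exp_coarse X \<E>)) X \<E> f \<and>
     (\<forall>A\<in>two_subsets X. f A \<in> A)"

text \<open>The families defined above are coarse structures with the intended bases.\<close>

lemma generated_coarse:
  assumes sub: "\<And>B. B \<in> \<B> \<Longrightarrow> B \<subseteq> X \<times> X \<and> Id_on X \<subseteq> B"
    and comp: "\<And>B C. B \<in> \<B> \<Longrightarrow> C \<in> \<B> \<Longrightarrow> \<exists>D\<in>\<B>. B O C \<subseteq> D"
    and conv: "\<And>B. B \<in> \<B> \<Longrightarrow> \<exists>D\<in>\<B>. B\<inverse> \<subseteq> D"
  shows "coarse_structure X (generated_coarse X \<B>)"
    and "coarse_base \<B> (generated_coarse X \<B>)"
proof -
  have O: "E O E' \<in> generated_coarse X \<B>"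
    if E: "E \<in> generated_coarse X \<B>" and E': "E' \<in> generated_coarse X \<B>" for E E'
  proof -
    obtain B C where "B \<in> \<B>" "E \<subseteq> B" "C \<in> \<B>" "E' \<subseteq> C"
      using E E' by (auto simp: generated_coarse_def)
    moreover from this obtain D where "D \<in> \<B>" "B O C \<subseteq> D" using comp by blast
    ultimately have "\<exists>D\<in>\<B>. E O E' \<subseteq> D" by blast
    moreover have "Id_on X \<subseteq> E O E'" using E E' unfolding generated_coarse_def by blast
    ultimately show ?thesis by (simp add: generated_coarse_def)
  qed
  have I: "E\<inverse> \<in> generated_coarse X \<B>" if E: "E \<in> generated_coarse X \<B>" for E
  proof -
    obtain B where "B \<in> \<B>" "E \<subseteq> B" using E by (auto simp: generated_coarse_def)
    moreover from this obtain D where "D \<in> \<B>" "B\<inverse> \<subseteq> D" using conv by blast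
    ultimately have "\<exists>D\<in>\<B>. E\<inverse> \<subseteq> D" by blast
    moreover have "Id_on X \<subseteq> E\<inverse>" using E unfolding generated_coarse_def by blast
    ultimately show ?thesis by (simp add: generated_coarse_def)
  qed
  have S: "E \<subseteq> X \<times> X \<and> Id_on X \<subseteq> E" if E: "E \<in> generated_coarse X \<B>" for E
  proof -
    obtain B where B: "B \<in> \<B>" "E \<subseteq> B" and "Id_on X \<subseteq> E"
      using E by (auto simp: generated_coarse_def)
    moreover have "B \<subseteq> X \<times> X" using sub[OF B(1)] by (rule conjunct1)
    ultimately show ?thesis by (simp add: order_trans[of E B])
  qed
  have D: "E' \<in> generated_coarse X \<B>"
    if E: "E \<in> generated_coarse X \<B>" and E': "Id_on X \<subseteq> E'" "E' \<subseteq> E" for E E'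
  proof -
    obtain B where "B \<in> \<B>" "E \<subseteq> B" using E by (auto simp: generated_coarse_def)
    then have "\<exists>B\<in>\<B>. E' \<subseteq> B" using E'(2) by (meson order_trans)
    then show ?thesis using E'(1) by (simp add: generated_coarse_def)
  qed
  show "coarse_structure X (generated_coarse X \<B>)"
    unfolding coarse_structure_def
  proof (intro conjI ballI)
    fix E assume E: "E \<in> generated_coarse X \<B>"
    show "E \<subseteq> X \<times> X" "Id_on X \<subseteq> E" using S[OF E] by simp_all
    show "E\<inverse> \<in> generated_coarse X \<B>" by (rule I[OF E])
    show "\<forall>E'. Id_on X \<subseteq> E' \<and> E' \<subseteq> E \<longrightarrow> E' \<in> generated_coarse X \<B>"
      using D[OF E] by simp
    fix E' assume "E' \<in> generated_coarse X \<B>"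
    then show "E O E' \<in> generated_coarse X \<B>" by (rule O[OF E])
  qed
  have "\<B> \<subseteq> generated_coarse X \<B>"
  proof
    fix B assume "B \<in> \<B>"
    then show "B \<in> generated_coarse X \<B>"
      using sub[OF \<open>B \<in> \<B>\<close>] by (auto simp: generated_coarse_def)
  qed
  then show "coarse_base \<B> (generated_coarse X \<B>)"
    by (simp add: coarse_base_def generated_coarse_def)
qed

lemma finitary_coarse:
  assumes "group G"
  shows "coarse_structure (carrier G) (finitary_coarse G)"
    and "coarse_base (finitary_base G) (finitary_coarse G)"
proof -
  interpret group G by fact
  define U where "U F = {(x, y). y \<in> carrier G \<and> x \<in> F #>\<^bsub>G\<^esub> y}" for F
  have fb: "finitary_base G = {U F |F. F \<subseteq> carrier G \<and> finite F \<and> \<one>\<^bsub>G\<^esub> \<in> F}"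
    by (simp add: finitary_base_def U_def)
  have mem: "(x, y) \<in> U F \<longleftrightarrow> y \<in> carrier G \<and> (\<exists>g\<in>F. x = g \<otimes>\<^bsub>G\<^esub> y)" for x y F
    by (auto simp: U_def r_coset_def)
  have 1: "B \<subseteq> carrier G \<times> carrier G \<and> Id_on (carrier G) \<subseteq> B"
    if B: "B \<in> finitary_base G" for B
  proof -
    obtain F where F: "B = U F" "F \<subseteq> carrier G" "\<one>\<^bsub>G\<^esub> \<in> F" using B fb by auto
    have "B \<subseteq> carrier G \<times> carrier G" using F by (auto simp: mem subset_iff)
    moreover have "Id_on (carrier G) \<subseteq> B" using F by (force simp: mem)
    ultimately show ?thesis ..
  qed
  have 2: "\<exists>D\<in>finitary_base G. B O C \<subseteq> D"
    if B: "B \<in> finitary_base G" and C: "C \<in> finitary_base G" for B C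
  proof -
    obtain F where F: "B = U F" "F \<subseteq> carrier G" "finite F" "\<one>\<^bsub>G\<^esub> \<in> F" using B fb by auto
    obtain H where H: "C = U H" "H \<subseteq> carrier G" "finite H" "\<one>\<^bsub>G\<^esub> \<in> H" using C fb by auto
    let ?K = "(\<lambda>(f, h). f \<otimes>\<^bsub>G\<^esub> h) ` (F \<times> H)"
    have "\<one>\<^bsub>G\<^esub> \<in> ?K" using F(4) H(4) by (intro image_eqI[of _ _ "(\<one>\<^bsub>G\<^esub>, \<one>\<^bsub>G\<^esub>)"]) auto
    moreover have "?K \<subseteq> carrier G" "finite ?K" using F H by auto
    ultimately have "U ?K \<in> finitary_base G" unfolding fb by blast
    moreover have "B O C \<subseteq> U ?K"
    proof clarify
      fix x y z assume "(x, y) \<in> B" "(y, z) \<in> C"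
      then obtain f h where "z \<in> carrier G" "f \<in> F" "h \<in> H" "x = f \<otimes>\<^bsub>G\<^esub> y" "y = h \<otimes>\<^bsub>G\<^esub> z"
        using F(1) H(1) by (auto simp: mem)
      moreover from this have "x = (f \<otimes>\<^bsub>G\<^esub> h) \<otimes>\<^bsub>G\<^esub> z"
        using F(2) H(2) by (simp add: m_assoc subset_iff)
      moreover have "f \<otimes>\<^bsub>G\<^esub> h \<in> ?K" using \<open>f \<in> F\<close> \<open>h \<in> H\<close> by force
      ultimately show "(x, z) \<in> U ?K" unfolding mem by blast
    qed
    ultimately show ?thesis by blast
  qed
  have 3: "\<exists>D\<in>finitary_base G. B\<inverse> \<subseteq> D" if B: "B \<in> finitary_base G" for B
  proof -
    obtain F where F: "B = U F" "F \<subseteq> carrier G" "finite F" "\<one>\<^bsub>G\<^esub> \<in> F" using B fb by auto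
    let ?K = "(\<lambda>f. inv\<^bsub>G\<^esub> f) ` F"
    have "\<one>\<^bsub>G\<^esub> \<in> ?K" using F(4) by (intro image_eqI[of _ _ "\<one>\<^bsub>G\<^esub>"]) auto
    moreover have "?K \<subseteq> carrier G" "finite ?K" using F by auto
    ultimately have "U ?K \<in> finitary_base G" unfolding fb by blast
    moreover have "B\<inverse> \<subseteq> U ?K"
    proof clarify
      fix x y assume "(x, y) \<in> B"
      then obtain g where g: "y \<in> carrier G" "g \<in> F" "x = g \<otimes>\<^bsub>G\<^esub> y" using F by (auto simp: mem)
      then have "g \<in> carrier G" using F by auto
      then have "y = inv\<^bsub>G\<^esub> g \<otimes>\<^bsub>G\<^esub> x" "x \<in> carrier G" using g by (auto simp: inv_solve_left)
      then show "(y, x) \<in> U ?K" using g by (auto simp: mem)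
    qed
    ultimately show ?thesis by blast
  qed
  show "coarse_structure (carrier G) (finitary_coarse G)"
    unfolding finitary_coarse_def by (rule generated_coarse(1)[OF 1 2 3])
  show "coarse_base (finitary_base G) (finitary_coarse G)"
    unfolding finitary_coarse_def by (rule generated_coarse(2)[OF 1 2 3])
qed

lemma exp_coarse:
  assumes "coarse_structure X \<E>"
  shows "coarse_structure (exp_space X) (exp_coarse X \<E>)"
    and "coarse_base (exp_entourage X ` \<E>) (exp_coarse X \<E>)"
proof -
  have ent: "\<forall>E\<in>\<E>. E \<subseteq> X \<times> X \<and> Id_on X \<subseteq> E" and O: "\<forall>E\<in>\<E>. \<forall>E'\<in>\<E>. E O E' \<in> \<E>"
    using assms unfolding coarse_structure_def by - (elim conjE, assumption)+
  have diag: "(x, x) \<in> E" if "E \<in> \<E>" "x \<in> X" for E x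
    using bspec[OF ent that(1)] that(2) by auto
  have sub: "E \<subseteq> X \<times> X" if "E \<in> \<E>" for E
    using bspec[OF ent that] by simp
  have comp: "E O E' \<in> \<E>" if "E \<in> \<E>" "E' \<in> \<E>" for E E'
    using O that by simp
  have 1: "B \<subseteq> exp_space X \<times> exp_space X \<and> Id_on (exp_space X) \<subseteq> B"
    if "B \<in> exp_entourage X ` \<E>" for B
  proof -
    obtain E where E: "E \<in> \<E>" "B = exp_entourage X E" using \<open>B \<in> exp_entourage X ` \<E>\<close> by blast
    have "A \<subseteq> E `` A" if "A \<in> exp_space X" for A
    proof
      fix x assume "x \<in> A"
      moreover from this have "x \<in> X" using that by (auto simp: exp_space_def)
      ultimately show "x \<in> E `` A" using diag[OF E(1)] by blast
    qed
    then have "Id_on (exp_space X) \<subseteq> B"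
      unfolding E(2) exp_entourage_def by (simp add: Id_on_def subset_iff)
    moreover have "B \<subseteq> exp_space X \<times> exp_space X"
      unfolding E(2) exp_entourage_def by blast
    ultimately show ?thesis by simp
  qed
  have 2: "\<exists>D\<in>exp_entourage X ` \<E>. B O C \<subseteq> D"
    if B: "B \<in> exp_entourage X ` \<E>" and C: "C \<in> exp_entourage X ` \<E>" for B C
  proof -
    obtain E where E: "E \<in> \<E>" "B = exp_entourage X E" using B by blast
    obtain E' where E': "E' \<in> \<E>" "C = exp_entourage X E'" using C by blast
    define D where "D = (E O E') O (E' O E)"
    have D: "D \<in> \<E>" unfolding D_def using comp E E' by blast
    have "E O E' \<subseteq> D" "E' O E \<subseteq> D"
    proof -
      have refl: "(x, x) \<in> E O E'" "(x, x) \<in> E' O E" if "x \<in> X" for x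
        using diag[OF E(1) that] diag[OF E'(1) that] by (simp_all add: relcompI[of x x])
      have X: "E O E' \<subseteq> X \<times> X" "E' O E \<subseteq> X \<times> X"
        using sub[OF E(1)] sub[OF E'(1)] by auto
      show "E O E' \<subseteq> D"
      proof (rule subrelI)
        fix x y assume xy: "(x, y) \<in> E O E'"
        then have "y \<in> X" using subsetD[OF X(1) xy] by simp
        then show "(x, y) \<in> D" unfolding D_def by (rule relcompI[OF xy refl(2)])
      qed
      show "E' O E \<subseteq> D"
      proof (rule subrelI)
        fix x y assume xy: "(x, y) \<in> E' O E"
        then have "x \<in> X" using subsetD[OF X(2) xy] by simp
        then show "(x, y) \<in> D" unfolding D_def by (rule relcompI[OF refl(1) xy])
      qed
    qed
    then have im: "E' `` (E `` A) \<subseteq> D `` A" "E `` (E' `` A) \<subseteq> D `` A" for A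
      by (metis Image_mono relcomp_Image subset_refl)+
    have "B O C \<subseteq> exp_entourage X D"
    proof clarify
      fix P Q R assume "(P, Q) \<in> B" "(Q, R) \<in> C"
      then have PQ: "P \<in> exp_space X" "P \<subseteq> E `` Q" "Q \<subseteq> E `` P"
        and QR: "R \<in> exp_space X" "Q \<subseteq> E' `` R" "R \<subseteq> E' `` Q"
        unfolding E(2) E'(2) exp_entourage_def by auto
      have "P \<subseteq> D `` R" using PQ(2) Image_mono[OF subset_refl QR(2), of E] im(2) by (meson order_trans)
      moreover have "R \<subseteq> D `` P" using QR(3) Image_mono[OF subset_refl PQ(3), of E'] im(1) by (meson order_trans)
      ultimately show "(P, R) \<in> exp_entourage X D" using PQ(1) QR(1) by (simp add: exp_entourage_def)
    qed
    then show ?thesis using D by blast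
  qed
  have 3: "\<exists>D\<in>exp_entourage X ` \<E>. B\<inverse> \<subseteq> D" if "B \<in> exp_entourage X ` \<E>" for B
  proof (rule bexI[OF _ that])
    obtain E where "B = exp_entourage X E" using \<open>B \<in> exp_entourage X ` \<E>\<close> by blast
    then show "B\<inverse> \<subseteq> B" unfolding exp_entourage_def by auto
  qed
  show "coarse_structure (exp_space X) (exp_coarse X \<E>)"
    unfolding exp_coarse_def by (rule generated_coarse(1)[OF 1 2 3])
  show "coarse_base (exp_entourage X ` \<E>) (exp_coarse X \<E>)"
    unfolding exp_coarse_def by (rule generated_coarse(2)[OF 1 2 3])
qed

end

theory Submission
  imports Defs "HOL-Algebra.Generated_Groups" "HOL-Library.Countable_Set"
begin

text \<open>
  The content is that a 2-selector yields an interval order. A 2-selector is a tournament on \<open>G\<close>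
  whose outcome on pairs that are far apart is stable under bounded moves. If a subgroup \<open>\<langle>S\<rangle>\<close> is
  infinite, stability forces \<open>G\<close> to be generated by \<open>S\<close> and, for each \<open>s \<in> S\<close>, finitely many further
  elements; so \<open>G\<close> is either finitely generated or countable and locally finite. In the locally
  finite case, \<open>G\<close> is a union of finite subgroups \<open>H\<^sub>0 \<subseteq> H\<^sub>1 \<subseteq> \<dots>\<close>, and the colexicographic order
  given by the cosets makes every coset of every \<open>H\<^sub>n\<close> an interval. In the finitely generated case,
  the word length with a sign given by the tournament is, up to a bounded error, an isometry of \<open>G\<close>
  into the integers, and \<open>G\<close> is ordered by it.
\<close>

section \<open>Linear orders given as relations, and finite convex sets\<close>

lemma linear_order_onD:
  assumes "linear_order_on X r"
  shows "x \<in> X \<Longrightarrow> (x, x) \<in> r"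
    and "(x, y) \<in> r \<Longrightarrow> (y, z) \<in> r \<Longrightarrow> (x, z) \<in> r"
    and "(x, y) \<in> r \<Longrightarrow> (y, x) \<in> r \<Longrightarrow> x = y"
    and "x \<in> X \<Longrightarrow> y \<in> X \<Longrightarrow> (x, y) \<in> r \<or> (y, x) \<in> r"
    and "(x, y) \<in> r \<Longrightarrow> x \<in> X \<and> y \<in> X"
  using assms unfolding order_on_defs refl_on_def trans_def antisym_def total_on_def
  by (blast, blast, blast, metis, blast)

lemma linear_order_onI:
  assumes "r \<subseteq> X \<times> X"
    and "\<And>x. x \<in> X \<Longrightarrow> (x, x) \<in> r"
    and "\<And>x y z. (x, y) \<in> r \<Longrightarrow> (y, z) \<in> r \<Longrightarrow> (x, z) \<in> r"
    and "\<And>x y. (x, y) \<in> r \<Longrightarrow> (y, x) \<in> r \<Longrightarrow> x = y"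
    and "\<And>x y. x \<in> X \<Longrightarrow> y \<in> X \<Longrightarrow> x \<noteq> y \<Longrightarrow> (x, y) \<in> r \<or> (y, x) \<in> r"
  shows "linear_order_on X r"
  unfolding order_on_defs refl_on_def trans_def antisym_def total_on_def
  by (intro conjI ballI allI impI; rule assms; assumption)

lemma linear_order_finite_min:
  assumes "linear_order_on X r" "finite A" "A \<noteq> {}" "A \<subseteq> X"
  shows "\<exists>a\<in>A. \<forall>z\<in>A. (a, z) \<in> r"
  using assms(2-4)
proof (induction A rule: finite_ne_induct)
  case (singleton x)
  then show ?case using linear_order_onD(1)[OF assms(1)] by simp
next
  case (insert x A)
  then obtain a where a: "a \<in> A" "\<forall>z\<in>A. (a, z) \<in> r" by blast
  show ?case
  proof (cases "(a, x) \<in> r")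
    case True
    then show ?thesis using a by blast
  next
    case False
    then have "(x, a) \<in> r" using linear_order_onD(4)[OF assms(1)] a(1) insert.prems by blast
    then have "\<forall>z\<in>insert x A. (x, z) \<in> r"
      using a(2) linear_order_onD(1,2)[OF assms(1)] insert.prems by blast
    then show ?thesis by blast
  qed
qed

text \<open>A finite set contains its least and greatest element, and convexity fills in everything
  between. Convexity alone would not provide endpoints.\<close>

lemma finite_convex_interval:
  assumes r: "linear_order_on X r" and A: "finite A" "A \<subseteq> X" "x \<in> A"
    and conv: "\<And>a z b. a \<in> A \<Longrightarrow> b \<in> A \<Longrightarrow> (a, z) \<in> r \<Longrightarrow> (z, b) \<in> r \<Longrightarrow> z \<in> A"
  shows "\<exists>a\<in>X. \<exists>b\<in>X. (a, x) \<in> r \<and> (x, b) \<in> r \<and> A = {z\<in>X. (a, z) \<in> r \<and> (z, b) \<in> r}"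
proof -
  obtain a where a: "a \<in> A" "\<forall>z\<in>A. (a, z) \<in> r"
    using linear_order_finite_min[OF r A(1) _ A(2)] A(3) by blast
  \<comment> \<open>A greatest element is a least one for the converse order.\<close>
  have "linear_order_on X (r\<inverse>)" using r by simp
  then obtain b where b: "b \<in> A" "\<forall>z\<in>A. (z, b) \<in> r"
    using linear_order_finite_min[OF _ A(1) _ A(2)] A(3) by blast
  have "A = {z\<in>X. (a, z) \<in> r \<and> (z, b) \<in> r}"
    using a b conv A(2) by blast
  then show ?thesis using a b A(2,3) by blast
qed

section \<open>From interval orders to compatible orders to selectors\<close>

lemma interval_coarse_imp_compatible_order:
  assumes r: "linear_order_on X r" and E: "coarse_structure X \<E>" and I: "interval_coarse X \<E> r"
  shows "compatible_order X \<E> r"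
  unfolding compatible_order_def
proof
  \<comment> \<open>An interval entourage containing \<open>E\<close> serves as \<open>F\<close>: a
    point outside an interval lies on one side of all of it, hence on the same side of
    \<open>x\<close> and of everything that \<open>E\<close> relates to \<open>x\<close>.\<close>
  fix E assume "E \<in> \<E>"
  then obtain F where F: "F \<in> \<E>" "E \<subseteq> F" "interval_entourage X r F"
    using I unfolding interval_coarse_def coarse_base_def by blast
  have key: "((x, y) \<in> r - Id \<longrightarrow> (\<forall>x'\<in>E `` {x}. (x', y) \<in> r - Id)) \<and>
        ((y, x) \<in> r - Id \<longrightarrow> (\<forall>x'\<in>E `` {x}. (y, x') \<in> r - Id))"
    if x: "x \<in> X" and y: "y \<in> X - F `` {x}" for x y
  proof -
    obtain a b where ab: "a \<in> X" "b \<in> X" "(a, x) \<in> r" "(x, b) \<in> r"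
      "F `` {x} = {z\<in>X. (a, z) \<in> r \<and> (z, b) \<in> r}"
      using F(3)[unfolded interval_entourage_def, THEN bspec, OF x] by (elim bexE conjE)
    have Fx: "z \<in> F `` {x} \<longleftrightarrow> z \<in> X \<and> (a, z) \<in> r \<and> (z, b) \<in> r" for z
      unfolding ab(5) by simp
    have lt: "(x', y) \<in> r - Id" if "(x, y) \<in> r - Id" "x' \<in> E `` {x}" for x'
    proof -
      have x': "x' \<in> F `` {x}" using that(2) F(2) by blast
      then have "(x', b) \<in> r" using Fx by simp
      \<comment> \<open>Being above \<open>x\<close>, the point \<open>y\<close> is above the left
        end \<open>a\<close>; it can be outside the interval only by exceeding
        \<open>b\<close>.\<close>
      moreover have "(a, y) \<in> r" using that(1) ab(3) linear_order_onD(2)[OF r] by blast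
      then have "(b, y) \<in> r" using y Fx[of y] ab(1,2) linear_order_onD(4)[OF r, of y b] by simp
      ultimately have "(x', y) \<in> r" using linear_order_onD(2)[OF r] by blast
      then show ?thesis using x' y by blast
    qed
    have gt: "(y, x') \<in> r - Id" if "(y, x) \<in> r - Id" "x' \<in> E `` {x}" for x'
    proof -
      have x': "x' \<in> F `` {x}" using that(2) F(2) by blast
      then have "(a, x') \<in> r" using Fx by simp
      moreover have "(y, b) \<in> r" using that(1) ab(4) linear_order_onD(2)[OF r] by blast
      then have "(y, a) \<in> r" using y Fx[of y] ab(1,2) linear_order_onD(4)[OF r, of y a] by simp
      ultimately have "(y, x') \<in> r" using linear_order_onD(2)[OF r] by blast
      then show ?thesis using x' y by blast
    qed
    show ?thesis using lt gt by blast
  qed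
  show "\<exists>F\<in>\<E>. E \<subseteq> F \<and>
        (\<forall>x\<in>X. \<forall>y\<in>X - F `` {x}. x \<noteq> y \<longrightarrow>
           ((x, y) \<in> r - Id \<longrightarrow> (\<forall>x'\<in>E `` {x}. (x', y) \<in> r - Id)) \<and>
           ((y, x) \<in> r - Id \<longrightarrow> (\<forall>x'\<in>E `` {x}. (y, x') \<in> r - Id)))"
    by (rule bexI[of _ F], rule conjI, rule F(2), intro ballI, rule impI, rule key,
        assumption, assumption, rule F(1))
qed

lemma coarse_structureD:
  assumes "coarse_structure X \<E>" "E \<in> \<E>"
  shows "E \<subseteq> X \<times> X" "Id_on X \<subseteq> E" "E\<inverse> \<in> \<E>" "E' \<in> \<E> \<Longrightarrow> E O E' \<in> \<E>"
proof -
  have cs: "\<forall>E\<in>\<E>. E \<subseteq> X \<times> X \<and> Id_on X \<subseteq> E" "\<forall>E\<in>\<E>. \<forall>E'\<in>\<E>. E O E' \<in> \<E>"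
      "\<forall>E\<in>\<E>. E\<inverse> \<in> \<E>"
    using assms(1) unfolding coarse_structure_def by - (elim conjE, assumption)+
  show "E \<subseteq> X \<times> X" "Id_on X \<subseteq> E"
    using bspec[OF cs(1) assms(2)] by (rule conjunct1, rule conjunct2)
  show "E\<inverse> \<in> \<E>" by (rule bspec[OF cs(3) assms(2)])
  show "E' \<in> \<E> \<Longrightarrow> E O E' \<in> \<E>" by (rule bspec[OF bspec[OF cs(2) assms(2)]])
qed

text \<open>The composition replaces the union with the converse, because its membership in the
  structure is immediate from the axioms; the diagonal in \<open>E\<close> makes it large
  enough.\<close>

lemma coarse_structure_symmetric_hull:
  assumes "coarse_structure X \<E>" "E \<in> \<E>"
  shows "E O E\<inverse> \<in> \<E>" "E \<subseteq> E O E\<inverse>" "sym (E O E\<inverse>)"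
proof -
  note E = coarse_structureD(1-3)[OF assms]
  show "E O E\<inverse> \<in> \<E>" by (rule coarse_structureD(4)[OF assms E(3)])
  show "E \<subseteq> E O E\<inverse>"
  proof (rule subrelI)
    fix x y assume xy: "(x, y) \<in> E"
    then have "(y, y) \<in> E" using subsetD[OF E(1) xy] E(2) by auto
    then show "(x, y) \<in> E O E\<inverse>" by (intro relcompI[OF xy]) simp
  qed
  show "sym (E O E\<inverse>)" unfolding sym_def by blast
qed

text \<open>The selector takes the smaller point. For close pairs the smaller points are close, or
  each is close only to the larger point of the other pair; compatibility allows such a crossing
  only if the pairs themselves are narrow.\<close>

lemma compatible_order_imp_two_selector:
  assumes r: "linear_order_on X r" and cs: "coarse_structure X \<E>" and co: "compatible_order X \<E> r"
  shows "\<exists>f. two_selector X \<E> f"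
proof -
  define f where "f A = (SOME a. a \<in> A \<and> (\<forall>z\<in>A. (a, z) \<in> r))" for A
  have f: "f A \<in> A" "\<And>z. z \<in> A \<Longrightarrow> (f A, z) \<in> r" if "A \<in> two_subsets X" for A
  proof -
    have "\<exists>a. a \<in> A \<and> (\<forall>z\<in>A. (a, z) \<in> r)"
      using linear_order_finite_min[OF r, of A] that
      unfolding two_subsets_def by (auto simp: card_2_iff)
    from someI_ex[OF this] show "f A \<in> A" "\<And>z. z \<in> A \<Longrightarrow> (f A, z) \<in> r"
      unfolding f_def by blast+
  qed
  have pair: "\<exists>y. A = {f A, y} \<and> f A \<noteq> y \<and> f A \<in> X \<and> y \<in> X \<and> (f A, y) \<in> r"
    if "A \<in> two_subsets X" for A
    using f[OF that] that unfolding two_subsets_def by (auto simp: card_2_iff)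
  have "\<exists>E'\<in>\<E>. \<forall>A\<in>two_subsets X. f ` (P `` {A}) \<subseteq> E' `` {f A}"
    if P: "P \<in> subspace_coarse (two_subsets X) (exp_coarse X \<E>)" for P
  proof -
    obtain E where E: "E \<in> \<E>" "P \<subseteq> exp_entourage X E \<inter> (two_subsets X \<times> two_subsets X)"
      using P unfolding subspace_coarse_def exp_coarse_def generated_coarse_def by blast
    define S where "S = E O E\<inverse>"
    have S: "S \<in> \<E>" "E \<subseteq> S" "sym S"
      unfolding S_def using coarse_structure_symmetric_hull[OF cs E(1)] by simp_all
    obtain F where F: "F \<in> \<E>" "S \<subseteq> F" and comp:
        "\<And>x y. x \<in> X \<Longrightarrow> y \<in> X \<Longrightarrow> (x, y) \<notin> F \<Longrightarrow> x \<noteq> y \<Longrightarrow>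
           ((x, y) \<in> r \<longrightarrow> (\<forall>x'\<in>S `` {x}. (x', y) \<in> r - Id)) \<and>
           ((y, x) \<in> r \<longrightarrow> (\<forall>x'\<in>S `` {x}. (y, x') \<in> r - Id))"
      using co[unfolded compatible_order_def, THEN bspec, OF S(1)] by auto
    define W where "W = F O F\<inverse>"
    have W: "W \<in> \<E>" "F \<subseteq> W" "sym W"
      unfolding W_def using coarse_structure_symmetric_hull[OF cs F(1)] by simp_all
    have SW: "S \<subseteq> W" using F(2) W(2) by blast
    have D: "W O W O W \<in> \<E>" by (intro coarse_structureD(4)[OF cs] W(1))
    have refl: "(x, x) \<in> W" if "x \<in> X" for x
      using coarse_structureD(2)[OF cs W(1)] that by blast
    have "(f A, f B) \<in> W O W O W" if AB: "(A, B) \<in> P" for A B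
    proof -
      have A: "A \<in> two_subsets X" and B: "B \<in> two_subsets X"
        and AB': "A \<subseteq> E `` B" "B \<subseteq> E `` A"
        using AB E(2) unfolding exp_entourage_def by auto
      obtain y where y: "A = {f A, y}" "f A \<noteq> y" "f A \<in> X" "y \<in> X" "(f A, y) \<in> r"
        using pair[OF A] by blast
      obtain v where v: "B = {f B, v}" "f B \<noteq> v" "f B \<in> X" "v \<in> X" "(f B, v) \<in> r"
        using pair[OF B] by blast
      define x u where xu: "x = f A" "u = f B"
      note y' = y[folded xu] and v' = v[folded xu]
      have AS: "A \<subseteq> S `` B" "B \<subseteq> S `` A" using AB' S(2) by blast+
      have symS: "(p, q) \<in> S \<Longrightarrow> (q, p) \<in> S" for p q using S(3) by (rule symD)
      have symW: "(p, q) \<in> W \<Longrightarrow> (q, p) \<in> W" for p q using W(3) by (rule symD)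
      \<comment> \<open>The minimum \<open>u\<close> of \<open>B\<close> is close to one of the two
        points of \<open>A\<close>; only closeness to the larger one, \<open>y\<close>, needs an
        argument.\<close>
      have "(x, u) \<in> W \<or> (u, y) \<in> S"
        using AS(2) y'(1) v'(1) SW symS by blast
      moreover have "(x, u) \<in> W O W O W" if "(x, u) \<in> W"
        using that refl y'(3) by blast
      moreover have ?thesis if uy: "(u, y) \<in> S" "(x, u) \<notin> W"
      proof -
        \<comment> \<open>The matching is crossed: \<open>x\<close> goes with \<open>v\<close> and
          \<open>y\<close> with \<open>u\<close>.\<close>
        have "(x, v) \<in> S" using AS(1) y'(1) v'(1) uy(2) SW symS by blast
        have "(x, y) \<in> W O W"
        proof (rule ccontr)
          \<comment> \<open>If \<open>x\<close> and \<open>y\<close> are far apart, moving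
            \<open>x\<close> to \<open>v\<close> keeps it below \<open>y\<close>, and then moving
            \<open>y\<close> to \<open>u\<close> keeps it above \<open>v\<close>. This puts
            \<open>v\<close> below \<open>u\<close>, the minimum of \<open>B\<close>.\<close>
          assume neg: "(x, y) \<notin> W O W"
          then have "(x, y) \<notin> F" "(y, v) \<notin> F"
            using W(2) SW \<open>(x, v) \<in> S\<close> refl y'(3) symW by blast+
          have "(v, y) \<in> r - Id"
            using comp[OF y'(3,4) \<open>(x, y) \<notin> F\<close> y'(2)] y'(5) \<open>(x, v) \<in> S\<close> by blast
          then have "(v, u) \<in> r - Id"
            using comp[OF y'(4) v'(4) \<open>(y, v) \<notin> F\<close>] uy(1) symS by blast
          then show False using v'(5) linear_order_onD(3)[OF r] by blast
        qed
        then have "(x, u) \<in> W O W O W" using uy(1) symS SW by blast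
        then show ?thesis unfolding xu .
      qed
      ultimately show ?thesis unfolding xu by blast
    qed
    then show ?thesis using D by blast
  qed
  moreover have "f ` two_subsets X \<subseteq> X"
    using pair by (intro image_subsetI) metis
  ultimately have "two_selector X \<E> f"
    unfolding two_selector_def macro_uniform_def using f(1) by simp
  then show ?thesis by (rule exI[where x = f])
qed

section \<open>Tournaments on a group and the generators that they force\<close>

context group
begin

text \<open>Since \<open>x\<close> lies in \<open>F #> y\<close> exactly when the quotient
  \<open>x \<otimes> inv y\<close> is in \<open>F\<close>, an entourage is a relation whose
  quotients stay in a finite set.\<close>

lemma finitary_coarse_iff:
  "E \<in> finitary_coarse G \<longleftrightarrow> Id_on (carrier G) \<subseteq> E \<and>
     (\<exists>F. finite F \<and> F \<subseteq> carrier G \<and>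
        (\<forall>(x, y)\<in>E. x \<in> carrier G \<and> y \<in> carrier G \<and> x \<otimes> inv y \<in> F))"
  (is "_ \<longleftrightarrow> ?I \<and> ?R")
proof
  assume "E \<in> finitary_coarse G"
  then obtain B where I: "?I" and B: "B \<in> finitary_base G" "E \<subseteq> B"
    unfolding finitary_coarse_def generated_coarse_def by auto
  obtain F where F: "F \<subseteq> carrier G" "finite F" "B = {(x, y). y \<in> carrier G \<and> x \<in> F #> y}"
    using B(1) unfolding finitary_base_def by auto
  have "x \<in> carrier G \<and> y \<in> carrier G \<and> x \<otimes> inv y \<in> F" if "(x, y) \<in> E" for x y
  proof -
    have "y \<in> carrier G" "x \<in> F #> y" using subsetD[OF B(2) that] F(3) by simp_all
    then obtain g where g: "y \<in> carrier G" "g \<in> F" "x = g \<otimes> y"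
      by (auto simp: r_coset_def)
    then have "g \<in> carrier G" using F(1) by auto
    then show ?thesis using g by (simp add: m_assoc)
  qed
  then show "?I \<and> ?R" using I F(1,2) by (intro conjI exI[of _ F]) auto
next
  assume IR: "?I \<and> ?R"
  then obtain F where F: "finite F" "F \<subseteq> carrier G"
      "\<forall>(x, y)\<in>E. x \<in> carrier G \<and> y \<in> carrier G \<and> x \<otimes> inv y \<in> F" by (elim conjE exE)
  \<comment> \<open>The unit is inserted because the sets defining \<open>finitary_base\<close> must
    contain it.\<close>
  let ?U = "{(x, y). y \<in> carrier G \<and> x \<in> insert \<one> F #> y}"
  have "E \<subseteq> ?U"
  proof (rule subrelI)
    fix x y assume "(x, y) \<in> E"
    then have *: "x \<in> carrier G" "y \<in> carrier G" "x \<otimes> inv y \<in> F" using F(3) by auto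
    then have "x = (x \<otimes> inv y) \<otimes> y" by (simp add: m_assoc)
    then have "x \<in> insert \<one> F #> y" using *(3) unfolding r_coset_def by auto
    then show "(x, y) \<in> ?U" using *(2) by simp
  qed
  moreover have "?U \<in> finitary_base G"
    unfolding finitary_base_def using F(1,2) by (intro CollectI exI[of _ "insert \<one> F"]) simp
  ultimately show "E \<in> finitary_coarse G"
    using IR unfolding finitary_coarse_def generated_coarse_def by auto
qed

text \<open>\<open>T x y\<close> reads \<open>x\<close> wins against \<open>y\<close>; players with \<open>y \<otimes> inv x \<notin> K\<close> count as far apart.\<close>

definition coarse_tournament :: "('a \<Rightarrow> 'a \<Rightarrow> bool) \<Rightarrow> bool" where
  "coarse_tournament T \<longleftrightarrow>
     (\<forall>x\<in>carrier G. \<forall>y\<in>carrier G. x \<noteq> y \<longrightarrow> T x y \<noteq> T y x) \<and>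
     (\<forall>F. finite F \<and> F \<subseteq> carrier G \<longrightarrow> (\<exists>K. finite K \<and> K \<subseteq> carrier G \<and>
        (\<forall>x\<in>carrier G. \<forall>y\<in>carrier G. y \<otimes> inv x \<notin> K \<longrightarrow>
           (\<forall>a\<in>F. \<forall>b\<in>F. T (a \<otimes> x) (b \<otimes> y) = T x y))))"

lemma coarse_tournament_antisym:
  "coarse_tournament T \<Longrightarrow> x \<in> carrier G \<Longrightarrow> y \<in> carrier G \<Longrightarrow> x \<noteq> y \<Longrightarrow> T x y \<noteq> T y x"
  unfolding coarse_tournament_def by (elim conjE) (drule (1) bspec, drule (1) bspec, drule (1) mp)

lemma coarse_tournamentE:
  assumes "coarse_tournament T" "finite F" "F \<subseteq> carrier G"
  obtains K where "finite K" "K \<subseteq> carrier G"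
    "\<forall>x\<in>carrier G. \<forall>y\<in>carrier G. y \<otimes> inv x \<notin> K \<longrightarrow>
       (\<forall>a\<in>F. \<forall>b\<in>F. T (a \<otimes> x) (b \<otimes> y) = T x y)"
proof -
  have "\<exists>K. finite K \<and> K \<subseteq> carrier G \<and>
        (\<forall>x\<in>carrier G. \<forall>y\<in>carrier G. y \<otimes> inv x \<notin> K \<longrightarrow>
           (\<forall>a\<in>F. \<forall>b\<in>F. T (a \<otimes> x) (b \<otimes> y) = T x y))"
    by (rule assms(1)[unfolded coarse_tournament_def, THEN conjunct2, THEN spec, THEN mp,
          OF conjI[OF assms(2,3)]])
  then obtain K where K: "finite K" "K \<subseteq> carrier G"
      "\<forall>x\<in>carrier G. \<forall>y\<in>carrier G. y \<otimes> inv x \<notin> K \<longrightarrow>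
           (\<forall>a\<in>F. \<forall>b\<in>F. T (a \<otimes> x) (b \<otimes> y) = T x y)"
    by (elim exE conjE)
  then show thesis by (rule that)
qed

text \<open>The selected point is the winner. Macro-uniformity keeps the winners of two close pairs
  close; a change of outcome would make the two players close to each other, which fails for a wide
  pair.\<close>

lemma two_selector_imp_coarse_tournament:
  assumes "two_selector (carrier G) (finitary_coarse G) f"
  shows "coarse_tournament (\<lambda>x y. f {x, y} = x)"
  unfolding coarse_tournament_def
proof (intro conjI ballI allI impI)
  have f: "f A \<in> A" if "A \<in> two_subsets (carrier G)" for A
    by (rule assms[unfolded two_selector_def, THEN conjunct2, THEN bspec, OF that])
  have two: "{x, y} \<in> two_subsets (carrier G)" if "x \<in> carrier G" "y \<in> carrier G" "x \<noteq> y" for x y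
    using that unfolding two_subsets_def by simp
  show "(f {x, y} = x) \<noteq> (f {y, x} = y)" if "x \<in> carrier G" "y \<in> carrier G" "x \<noteq> y" for x y
    using f[OF two[OF that]] that(3) by (auto simp: insert_commute)
  fix F assume F: "finite F \<and> F \<subseteq> carrier G"
  let ?X = "carrier G"
  \<comment> \<open>Closed under inverses because closeness of pairs in \<open>exp_entourage\<close>
    is required in both directions; the unit provides the diagonal.\<close>
  define F' where "F' = insert \<one> (F \<union> m_inv G ` F)"
  define E where "E = {(x, y). x \<in> ?X \<and> y \<in> ?X \<and> x \<otimes> inv y \<in> F'}"
  have F': "finite F'" "F' \<subseteq> ?X" using F by (auto simp: F'_def)
  have "Id_on ?X \<subseteq> E" by (auto simp: E_def F'_def)
  then have E: "E \<in> finitary_coarse G"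
    unfolding finitary_coarse_iff using F' by (intro conjI exI[of _ F']) (simp_all add: E_def)
  define P where "P = exp_entourage ?X E \<inter> (two_subsets ?X \<times> two_subsets ?X)"
  have "exp_entourage ?X E \<in> exp_coarse ?X (finitary_coarse G)"
    by (rule subsetD[OF exp_coarse(2)[OF finitary_coarse(1)[OF is_group],
          unfolded coarse_base_def, THEN conjunct1] imageI[OF E]])
  then have P: "P \<in> subspace_coarse (two_subsets ?X) (exp_coarse ?X (finitary_coarse G))"
    unfolding subspace_coarse_def P_def by auto
  obtain E' where E': "E' \<in> finitary_coarse G"
      "\<forall>A\<in>two_subsets ?X. f ` (P `` {A}) \<subseteq> E' `` {f A}"
    using assms[unfolded two_selector_def macro_uniform_def,
        THEN conjunct1, THEN conjunct2, THEN bspec, OF P] by (elim bexE)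
  obtain M where M: "finite M" "M \<subseteq> ?X"
      "\<forall>(x, y)\<in>E'. x \<in> ?X \<and> y \<in> ?X \<and> x \<otimes> inv y \<in> M"
    using finitary_coarse_iff[THEN iffD1, OF E'(1)] by (elim conjE exE)
  \<comment> \<open>The first piece keeps the two players distinct before and after the move. The
    other two collect the quotients \<open>y \<otimes> inv x\<close> for which the winner could
    change from \<open>x\<close> to \<open>b \<otimes> y\<close>, or from \<open>y\<close> to
    \<open>a \<otimes> x\<close>.\<close>
  define K where "K = (\<lambda>(b, a). inv b \<otimes> a) ` (F' \<times> F') \<union>
      (\<lambda>(b, m). inv b \<otimes> inv m) ` (F' \<times> M) \<union> (\<lambda>(m, a). m \<otimes> a) ` (M \<times> F')"
  have K: "finite K" "K \<subseteq> ?X" using F' M(1,2) by (auto simp: K_def)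
  have KI: "inv b \<otimes> a \<in> K" "inv b \<otimes> inv m \<in> K" "m \<otimes> a \<in> K"
    if "a \<in> F'" "b \<in> F'" "m \<in> M" for a b m
    using that unfolding K_def by auto
  have KI1: "inv b \<otimes> a \<in> K" if "a \<in> F'" "b \<in> F'" for a b
    using that unfolding K_def by auto
  have "f {a \<otimes> x, b \<otimes> y} = a \<otimes> x \<longleftrightarrow> f {x, y} = x"
    if xy: "x \<in> ?X" "y \<in> ?X" "y \<otimes> inv x \<notin> K" and ab: "a \<in> F" "b \<in> F" for x y a b
  proof -
    have ab': "a \<in> F'" "b \<in> F'" "\<one> \<in> F'" "inv a \<in> F'" "inv b \<in> F'" "a \<in> ?X" "b \<in> ?X"
      using ab F unfolding F'_def by auto
    have "x \<noteq> y" using xy KI1[OF ab'(3,3)] by auto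
    have ne: "a \<otimes> x \<noteq> b \<otimes> y"
    proof
      assume "a \<otimes> x = b \<otimes> y"
      then have "y = inv b \<otimes> (a \<otimes> x)" using xy ab' by (simp add: inv_solve_left)
      then have "y \<otimes> inv x = inv b \<otimes> a" using xy ab' by (simp add: m_assoc)
      then show False using xy(3) KI1[OF ab'(1,2)] by simp
    qed
    let ?A = "{x, y}" and ?B = "{a \<otimes> x, b \<otimes> y}"
    have A: "?A \<in> two_subsets ?X" and B: "?B \<in> two_subsets ?X"
      using two[OF xy(1,2) \<open>x \<noteq> y\<close>] two[OF _ _ ne] xy ab' by simp_all
    have "(x, a \<otimes> x) \<in> E" "(a \<otimes> x, x) \<in> E" "(y, b \<otimes> y) \<in> E" "(b \<otimes> y, y) \<in> E"
      using xy ab' unfolding E_def by (simp_all add: m_assoc inv_mult_group)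
        (simp_all flip: m_assoc)
    then have "(?A, ?B) \<in> exp_entourage ?X E"
      using A B unfolding exp_entourage_def exp_space_def two_subsets_def by auto
    then have "(?A, ?B) \<in> P" using A B by (simp add: P_def)
    then have "(f ?A, f ?B) \<in> E'" using bspec[OF E'(2) A] by auto
    then have m: "f ?A \<otimes> inv (f ?B) \<in> M" using M(3) by auto
    consider "f ?A = x" "f ?B = a \<otimes> x" | "f ?A = y" "f ?B = b \<otimes> y"
      | "f ?A = x" "f ?B = b \<otimes> y" | "f ?A = y" "f ?B = a \<otimes> x"
      using f[OF A] f[OF B] by blast
    then show ?thesis
    proof cases
      case 3
      then have "inv b \<otimes> inv (x \<otimes> inv (b \<otimes> y)) \<in> K" using KI(2)[OF ab'(1,2)] m by simp
      moreover have "inv b \<otimes> inv (x \<otimes> inv (b \<otimes> y)) = y \<otimes> inv x"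
        using xy ab' by (simp add: inv_mult_group m_assoc) (simp flip: m_assoc)
      ultimately show ?thesis using xy(3) by simp
    next
      case 4
      then have "y \<otimes> inv (a \<otimes> x) \<otimes> a \<in> K" using KI(3)[OF ab'(1,2)] m by simp
      moreover have "y \<otimes> inv (a \<otimes> x) \<otimes> a = y \<otimes> inv x"
        using xy ab' by (simp add: inv_mult_group m_assoc)
      ultimately show ?thesis using xy(3) by simp
    qed (use \<open>x \<noteq> y\<close> ne in auto)
  qed
  then show "\<exists>K. finite K \<and> K \<subseteq> ?X \<and> (\<forall>x\<in>?X. \<forall>y\<in>?X. y \<otimes> inv x \<notin> K \<longrightarrow>
      (\<forall>a\<in>F. \<forall>b\<in>F. (f {a \<otimes> x, b \<otimes> y} = a \<otimes> x) = (f {x, y} = x)))"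
    using K by (intro exI[of _ K] conjI ballI impI)
qed

text \<open>If some \<open>g\<close> were outside the right hand side, then \<open>T h (g \<otimes> h')\<close> would not depend on
  \<open>h \<in> H\<close>, and neither would \<open>T h h'\<close> for \<open>h, h' \<in> H\<close> far apart; three elements of \<open>H\<close> far
  apart contradict the antisymmetry of \<open>T\<close>.\<close>

lemma coarse_tournament_generators:
  assumes T: "coarse_tournament T" and S: "S \<subseteq> carrier G" and inf: "infinite (generate G S)"
  shows "\<exists>K. (\<forall>s\<in>S. finite (K s) \<and> K s \<subseteq> carrier G) \<and>
    carrier G = generate G (S \<union> (\<Union>s\<in>S. K s))"
proof -
  let ?H = "generate G S"
  have H: "?H \<subseteq> carrier G" by (rule generate_incl[OF S])
  \<comment> \<open>One finite set per generator: \<open>S\<close> may be infinite, and stability is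
    available only for finitely many moves at a time.\<close>
  have "\<exists>K. finite K \<and> K \<subseteq> carrier G \<and>
      (\<forall>x\<in>carrier G. \<forall>y\<in>carrier G. y \<otimes> inv x \<notin> K \<longrightarrow> T (s \<otimes> x) y = T x y)" if s: "s \<in> S" for s
  proof -
    have fs: "finite {\<one>, s}" "{\<one>, s} \<subseteq> carrier G" using s S by auto
    obtain K where K: "finite K" "K \<subseteq> carrier G"
        "\<forall>x\<in>carrier G. \<forall>y\<in>carrier G. y \<otimes> inv x \<notin> K \<longrightarrow>
           (\<forall>a\<in>{\<one>, s}. \<forall>b\<in>{\<one>, s}. T (a \<otimes> x) (b \<otimes> y) = T x y)"
      by (rule coarse_tournamentE[OF T fs], rule that)
    have "T (s \<otimes> x) y = T x y" if "x \<in> carrier G" "y \<in> carrier G" "y \<otimes> inv x \<notin> K" for x y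
      using K(3)[rule_format, OF that, of s \<one>] that by simp
    then show ?thesis using K(1,2) by blast
  qed
  then obtain K where K: "\<And>s. s \<in> S \<Longrightarrow> finite (K s) \<and> K s \<subseteq> carrier G"
    and inv: "\<And>s x y. \<lbrakk>s \<in> S; x \<in> carrier G; y \<in> carrier G; y \<otimes> inv x \<notin> K s\<rbrakk> \<Longrightarrow>
      T (s \<otimes> x) y = T x y"
    by metis
  let ?L = "S \<union> (\<Union>s\<in>S. K s)"
  have L: "?L \<subseteq> carrier G" using S K by blast
  have HL: "?H \<subseteq> generate G ?L" by (rule mono_generate) blast
  have False if g: "g \<in> carrier G" "g \<notin> generate G ?L" for g
  proof -
    \<comment> \<open>Write \<open>k\<close> as a word in \<open>S\<close> and apply its letters one
      by one. A letter \<open>s\<close> could change the outcome only if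
      \<open>g \<otimes> h' \<otimes> inv h\<close> were in \<open>K s\<close>, and then
      \<open>g\<close> would lie in the generated subgroup.\<close>
    have step: "T (k \<otimes> h) (g \<otimes> h') = T h (g \<otimes> h')"
      if "k \<in> ?H" "h \<in> ?H" "h' \<in> ?H" for k h h'
      using that(1,2)
    proof (induction arbitrary: h rule: generate.induct)
      case one
      then show ?case using H by auto
    next
      have *: "T (s \<otimes> h) (g \<otimes> h') = T h (g \<otimes> h')" if s: "s \<in> S" and h: "h \<in> ?H" for s h
      proof (rule inv[OF s])
        show hh: "h \<in> carrier G" "g \<otimes> h' \<in> carrier G" using h \<open>h' \<in> ?H\<close> g H by auto
        have h'c: "h' \<in> carrier G" using \<open>h' \<in> ?H\<close> H by auto
        show "g \<otimes> h' \<otimes> inv h \<notin> K s"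
        proof
          assume "g \<otimes> h' \<otimes> inv h \<in> K s"
          then have "g \<otimes> h' \<otimes> inv h \<in> generate G ?L" using s by (blast intro: generate.incl)
          moreover have "h \<otimes> inv h' \<in> generate G ?L"
            using HL h \<open>h' \<in> ?H\<close> generate_m_inv_closed[OF S] generate.eng[of h G S] by blast
          ultimately have "(g \<otimes> h' \<otimes> inv h) \<otimes> (h \<otimes> inv h') \<in> generate G ?L"
            by (rule generate.eng)
          moreover have "(g \<otimes> h' \<otimes> inv h) \<otimes> (h \<otimes> inv h') = g"
            using g hh h'c by (simp add: m_assoc inv_solve_left) (simp flip: m_assoc)
          ultimately show False using g(2) by simp
        qed
      qed
      {
        case (incl s)
        then show ?case by (rule *)
      next
        case (inv s)
        \<comment> \<open>Moving \<open>inv s \<otimes> h\<close> by \<open>s\<close> returns to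
          \<open>h\<close>, so an inverse letter is handled by the case of \<open>s\<close>.\<close>
        then have "inv s \<otimes> h \<in> ?H" by (blast intro: generate.intros)
        from *[OF inv(1) this] show ?case using inv S H by (simp add: m_assoc[symmetric] subset_iff)
      }
    next
      case (eng k1 k2)
      then show ?case using H by (simp add: m_assoc subset_iff generate.eng)
    qed
    have const: "T h (g \<otimes> h') = T \<one> (g \<otimes> h')" if "h \<in> ?H" "h' \<in> ?H" for h h'
      using step[OF that(1) generate.one that(2)] that(1) H by auto
    have fg: "finite {\<one>, g}" "{\<one>, g} \<subseteq> carrier G" using g by auto
    obtain K' where K': "finite K'" "K' \<subseteq> carrier G"
        "\<forall>x\<in>carrier G. \<forall>y\<in>carrier G. y \<otimes> inv x \<notin> K' \<longrightarrow>
           (\<forall>a\<in>{\<one>, g}. \<forall>b\<in>{\<one>, g}. T (a \<otimes> x) (b \<otimes> y) = T x y)"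
      by (rule coarse_tournamentE[OF T fg], rule that)
    \<comment> \<open>Stability under moving the second player by \<open>g\<close> transfers the
      constancy to pairs inside the subgroup: the outcome depends on \<open>h'\<close>
      alone.\<close>
    have far: "T h h' = T \<one> (g \<otimes> h')" if "h \<in> ?H" "h' \<in> ?H" "h' \<otimes> inv h \<notin> K'" for h h'
    proof -
      have "T (\<one> \<otimes> h) (g \<otimes> h') = T h h'" using that H by (intro K'(3)[rule_format]) auto
      then show ?thesis using const[OF that(1,2)] that(1) H by (simp add: subset_iff)
    qed
    \<comment> \<open>Avoiding \<open>D\<close> makes two elements distinct and far apart in both
      orders.\<close>
    define D where "D = insert \<one> (K' \<union> m_inv G ` K')"
    have D: "finite D" "D \<subseteq> carrier G" using K' by (auto simp: D_def)
    have pick: "\<exists>h\<in>?H. \<forall>h'\<in>A. h' \<otimes> inv h \<notin> K' \<and> h \<otimes> inv h' \<notin> K' \<and> h \<noteq> h'"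
      if A: "finite A" "A \<subseteq> ?H" for A
    proof -
      have "finite ((\<lambda>(d, a). d \<otimes> a) ` (D \<times> A))" using D A by blast
      then obtain h where h: "h \<in> ?H" "h \<notin> (\<lambda>(d, a). d \<otimes> a) ` (D \<times> A)"
        using inf by (meson finite_subset subsetI)
      have "h' \<otimes> inv h \<notin> K' \<and> h \<otimes> inv h' \<notin> K' \<and> h \<noteq> h'" if h': "h' \<in> A" for h'
      proof -
        have c: "h \<in> carrier G" "h' \<in> carrier G" using h h' A H by auto
        have nD: "h \<otimes> inv h' \<notin> D"
        proof
          assume "h \<otimes> inv h' \<in> D"
          moreover have "h = (h \<otimes> inv h') \<otimes> h'" using c by (simp add: m_assoc)
          ultimately show False using h(2) h' by force
        qed
        moreover have "h \<otimes> inv h' = inv (h' \<otimes> inv h)" using c by (simp add: inv_mult_group)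
        ultimately show ?thesis using c unfolding D_def by auto
      qed
      then show ?thesis using h(1) by blast
    qed
    obtain h1 h2 h3 where h: "h1 \<in> ?H" "h2 \<in> ?H" "h3 \<in> ?H"
      and 12: "h1 \<otimes> inv h2 \<notin> K' \<and> h2 \<otimes> inv h1 \<notin> K' \<and> h2 \<noteq> h1"
      and 13: "h1 \<otimes> inv h3 \<notin> K' \<and> h3 \<otimes> inv h1 \<notin> K' \<and> h3 \<noteq> h1"
      and 23: "h2 \<otimes> inv h3 \<notin> K' \<and> h3 \<otimes> inv h2 \<notin> K' \<and> h3 \<noteq> h2"
    proof -
      obtain h1 where 1: "h1 \<in> ?H" using generate.one by blast
      obtain h2 where 2: "h2 \<in> ?H" "\<forall>h'\<in>{h1}. h' \<otimes> inv h2 \<notin> K' \<and> h2 \<otimes> inv h' \<notin> K' \<and> h2 \<noteq> h'"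
        using pick[of "{h1}"] 1 by blast
      obtain h3 where "h3 \<in> ?H"
          "\<forall>h'\<in>{h1, h2}. h' \<otimes> inv h3 \<notin> K' \<and> h3 \<otimes> inv h' \<notin> K' \<and> h3 \<noteq> h'"
        using pick[of "{h1, h2}"] 1 2 by blast
      then show ?thesis using that 1 2 by simp
    qed
    \<comment> \<open>Each outcome depends only on its second player, so antisymmetry would require
      three pairwise different truth values.\<close>
    have "T h1 h2 \<noteq> T h2 h1" "T h1 h3 \<noteq> T h3 h1" "T h2 h3 \<noteq> T h3 h2"
      using coarse_tournament_antisym[OF T] h H 12 13 23 by (simp_all add: subset_iff)
    then show False
      using far[of h1 h2] far[of h2 h1] far[of h1 h3] far[of h3 h1] far[of h2 h3] far[of h3 h2]
        h 12 13 23 by blast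
  qed
  then have "carrier G = generate G ?L" using generate_incl[OF L] by blast
  then show ?thesis using K by blast
qed

end

section \<open>Colexicographic orders and quasi-lines\<close>

lemma colex_order:
  fixes c :: "nat \<Rightarrow> 'a \<Rightarrow> nat"
  assumes inj: "\<And>x y. x \<in> X \<Longrightarrow> y \<in> X \<Longrightarrow> c 0 x = c 0 y \<Longrightarrow> x = y"
    and ev: "\<And>x y. x \<in> X \<Longrightarrow> y \<in> X \<Longrightarrow> \<exists>n. \<forall>m\<ge>n. c m x = c m y"
    and r: "r = {(x, y). x \<in> X \<and> y \<in> X \<and> (x = y \<or> (\<exists>n. c n x < c n y \<and> (\<forall>m>n. c m x = c m y)))}"
  shows "linear_order_on X r"
    and "(a, z) \<in> r \<Longrightarrow> (z, b) \<in> r \<Longrightarrow> \<forall>m\<ge>n. c m a = c m b \<Longrightarrow> c n z = c n a"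
proof -
  \<comment> \<open>The index \<open>n\<close> is the last one where the sequences differ, and it
    decides the comparison.\<close>
  define lt where "lt x y n \<longleftrightarrow> c n x < c n y \<and> (\<forall>m>n. c m x = c m y)" for x y n
  have r_iff: "(x, y) \<in> r \<longleftrightarrow> x \<in> X \<and> y \<in> X \<and> (x = y \<or> (\<exists>n. lt x y n))" for x y
    unfolding r lt_def by simp
  \<comment> \<open>The later of the two deciding indices decides between the outer points. This
    also yields convexity: a point between \<open>a\<close> and \<open>b\<close> cannot differ from
    \<open>a\<close> beyond the last index where \<open>a\<close> and \<open>b\<close>
    differ.\<close>
  have lt_trans: "lt x z (max i j)" if "lt x y i" "lt y z j" for x y z i j
    using that unfolding lt_def by (cases i j rule: linorder_cases) (auto simp: max_def)
  show "linear_order_on X r"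
  proof (rule linear_order_onI)
    show "r \<subseteq> X \<times> X" "\<And>x. x \<in> X \<Longrightarrow> (x, x) \<in> r" by (auto simp: r_iff)
    show "(x, z) \<in> r" if "(x, y) \<in> r" "(y, z) \<in> r" for x y z
      using that lt_trans unfolding r_iff by metis
    show "x = y" if xy: "(x, y) \<in> r" "(y, x) \<in> r" for x y
    proof (rule ccontr)
      assume "x \<noteq> y"
      then obtain i j where "lt x y i" "lt y x j" using xy unfolding r_iff by auto
      from lt_trans[OF this] show False by (simp add: lt_def)
    qed
    show "(x, y) \<in> r \<or> (y, x) \<in> r" if xy: "x \<in> X" "y \<in> X" "x \<noteq> y" for x y
    proof -
      obtain n where n: "\<forall>m\<ge>n. c m x = c m y" using ev[OF xy(1,2)] by auto
      let ?D = "{m. c m x \<noteq> c m y}"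
      have "m < n" if "c m x \<noteq> c m y" for m using n that by (meson not_le)
      then have "?D \<subseteq> {..<n}" by auto
      then have fin: "finite ?D" by (rule finite_subset) simp
      have "?D \<noteq> {}" using inj[OF xy(1,2)] xy(3) by auto
      then obtain M where M: "c M x \<noteq> c M y" and max: "\<And>m. c m x \<noteq> c m y \<Longrightarrow> m \<le> M"
        using Max_in[OF fin] Max_ge[OF fin] by blast
      have "c m x = c m y" if "m > M" for m using max[of m] that by (meson not_le)
      then have "lt x y M \<or> lt y x M" using M unfolding lt_def by (metis linorder_neqE_nat)
      then show ?thesis using xy unfolding r_iff by auto
    qed
  qed
  show "c n z = c n a" if az: "(a, z) \<in> r" and zb: "(z, b) \<in> r" and ab: "\<forall>m\<ge>n. c m a = c m b"
  proof (cases "a = z \<or> z = b")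
    case True
    then show ?thesis using ab by auto
  next
    case False
    then obtain i j where ij: "lt a z i" "lt z b j" using az zb unfolding r_iff by auto
    then have "c (max i j) a < c (max i j) b" using lt_trans by (simp add: lt_def)
    then have "max i j < n" using ab by (metis less_irrefl not_le)
    then show ?thesis using ij(1) by (simp add: lt_def)
  qed
qed

text \<open>Transports \<open>P\<close> along a geodesic from \<open>x\<close> to \<open>y\<close>.
  The equation in \<open>step\<close> says that \<open>z\<close> lies on some geodesic, which is
  what bounds its distance from a third point.\<close>

lemma geodesic_walk:
  fixes d :: "'a \<Rightarrow> 'a \<Rightarrow> nat"
  assumes zero: "\<And>x y. x \<in> X \<Longrightarrow> y \<in> X \<Longrightarrow> d x y = 0 \<Longrightarrow> x = y"
    and tri: "\<And>x y z. x \<in> X \<Longrightarrow> y \<in> X \<Longrightarrow> z \<in> X \<Longrightarrow> d x z \<le> d x y + d y z"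
    and geo: "\<And>x y n. x \<in> X \<Longrightarrow> y \<in> X \<Longrightarrow> d x y = Suc n \<Longrightarrow> \<exists>z\<in>X. d x z = n \<and> d z y = 1"
    and x: "x \<in> X" "P x" and y: "y \<in> X"
    and step: "\<And>z z'. z \<in> X \<Longrightarrow> z' \<in> X \<Longrightarrow> d x z + d z y = d x y \<Longrightarrow> d z z' = 1 \<Longrightarrow> P z \<Longrightarrow> P z'"
  shows "P y"
  using y step
proof (induction "d x y" arbitrary: y)
  case 0
  then show ?case using zero[of x y] x by simp
next
  case (Suc n)
  obtain z where z: "z \<in> X" "d x z = n" "d z y = 1"
    using geo[OF x(1) Suc.prems(1) Suc.hyps(2)[symmetric]] by auto
  have "P z"
  proof (rule Suc.hyps(1)[OF z(2)[symmetric] z(1)])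
    fix w w' assume w: "w \<in> X" "w' \<in> X" "d x w + d w z = d x z" "d w w' = 1" "P w"
    \<comment> \<open>A point on a geodesic from \<open>x\<close> to \<open>z\<close> is on one from
      \<open>x\<close> to \<open>y\<close>, because \<open>z\<close> is.\<close>
    have "d x w + d w y = d x y"
      using tri[OF w(1) z(1) Suc.prems(1)] tri[OF x(1) w(1) Suc.prems(1)] w(3) z(2,3) Suc.hyps(2)
      by linarith
    then show "P w'" using Suc.prems(2) w by simp
  qed
  moreover have "d x z + d z y = d x y" using z(2,3) Suc.hyps(2) by simp
  ultimately show ?case using Suc.prems(2)[OF z(1) Suc.prems(1)] z(3) by simp
qed

text \<open>Measure the distance to a base point \<open>c\<close> and take the sign from the tournament. Points
  with the same sign and the same distance to \<open>c\<close> are close: otherwise \<open>c\<close> could be moved to \<open>y\<close>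
  far from \<open>x\<close> and to \<open>x\<close> far from \<open>y\<close>, giving \<open>T x y = T x c = T y c = T y x\<close>. A geodesic
  between points with different signs passes near \<open>c\<close>.\<close>

lemma tournament_quasi_line:
  fixes d :: "'a \<Rightarrow> 'a \<Rightarrow> nat" and T :: "'a \<Rightarrow> 'a \<Rightarrow> bool"
  assumes c: "c \<in> X"
    and zero: "\<And>x y. x \<in> X \<Longrightarrow> y \<in> X \<Longrightarrow> d x y = 0 \<longleftrightarrow> x = y"
    and com: "\<And>x y. x \<in> X \<Longrightarrow> y \<in> X \<Longrightarrow> d x y = d y x"
    and tri: "\<And>x y z. x \<in> X \<Longrightarrow> y \<in> X \<Longrightarrow> z \<in> X \<Longrightarrow> d x z \<le> d x y + d y z"
    and geo: "\<And>x y n. x \<in> X \<Longrightarrow> y \<in> X \<Longrightarrow> d x y = Suc n \<Longrightarrow> \<exists>z\<in>X. d x z = n \<and> d z y = 1"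
    and anti: "\<And>x y. x \<in> X \<Longrightarrow> y \<in> X \<Longrightarrow> x \<noteq> y \<Longrightarrow> T x y \<noteq> T y x"
    and move: "\<And>x x' y y'. \<lbrakk>x \<in> X; x' \<in> X; y \<in> X; y' \<in> X; d x y > R; d x x' \<le> 1; d y y' \<le> 1\<rbrakk> \<Longrightarrow>
      T x' y' = T x y"
  shows "\<exists>\<pi> :: 'a \<Rightarrow> int. \<forall>x\<in>X. \<forall>y\<in>X.
    \<bar>\<pi> x - \<pi> y\<bar> \<le> int (d x y + 2 * R) \<and> int (d x y) \<le> \<bar>\<pi> x - \<pi> y\<bar> + int (2 * R)"
proof -
  note walk = geodesic_walk[of X d, OF iffD1[OF zero] tri geo]
  have walk_c: "T x y = T x c"
    if x: "x \<in> X" and y: "y \<in> X" and far: "int (d x y) > \<bar>int (d x c) - int (d y c)\<bar> + int (2 * R)"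
    for x y
  proof (rule walk[of c "\<lambda>q. T x q = T x c" y])
    fix q q' assume q: "q \<in> X" "q' \<in> X" "d c q + d q y = d c y" "d q q' = 1" "T x q = T x c"
    have "d x q > R"
    proof (rule ccontr)
      \<comment> \<open>A geodesic from \<open>c\<close> to \<open>y\<close> that comes within
        \<open>R\<close> of \<open>x\<close> would give
        \<open>d x y \<le> d y c - d x c + 2 * R\<close>, against \<open>far\<close>.\<close>
      assume "\<not> d x q > R"
      then show False
        using tri[OF x q(1) y] tri[OF x q(1) c] com[OF c q(1)] com[OF c y] q(3) far by linarith
    qed
    then show "T x q' = T x c" using move[OF x x q(1,2)] zero[OF x x] q(4,5) by simp
  qed (use c y in simp_all)
  have same: "int (d x y) \<le> \<bar>int (d x c) - int (d y c)\<bar> + int (2 * R)"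
    if "x \<in> X" "y \<in> X" "T x c = T y c" for x y
  proof (rule ccontr)
    assume "\<not> int (d x y) \<le> \<bar>int (d x c) - int (d y c)\<bar> + int (2 * R)"
    then have far: "int (d x y) > \<bar>int (d x c) - int (d y c)\<bar> + int (2 * R)" by simp
    then have far': "int (d y x) > \<bar>int (d y c) - int (d x c)\<bar> + int (2 * R)"
      using com[OF that(1,2)] by linarith
    have "x \<noteq> y" using far zero[OF that(1,2)] by auto
    then show False using anti[OF that(1,2)] walk_c[OF that(1,2) far] walk_c[OF that(2,1) far'] that(3)
      by simp
  qed
  have opposite: "d x c + d y c \<le> d x y + 2 * R"
    if x: "x \<in> X" and y: "y \<in> X" and ne: "T x c \<noteq> T y c" for x y
  proof (rule ccontr)
    assume far: "\<not> d x c + d y c \<le> d x y + 2 * R"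
    have "T y c = T x c"
    proof (rule walk[of x "\<lambda>q. T q c = T x c" y])
      fix q q' assume q: "q \<in> X" "q' \<in> X" "d x q + d q y = d x y" "d q q' = 1" "T q c = T x c"
      \<comment> \<open>A geodesic point within \<open>R\<close> of \<open>c\<close> would bound
        \<open>d x c + d y c\<close> by \<open>d x y + 2 * R\<close>.\<close>
      have "d q c > R"
        using tri[OF x q(1) c] tri[OF y q(1) c] com[OF y q(1)] q(3) far by linarith
      then show "T q' c = T x c" using move[OF q(1,2) c c] zero[OF c c] q(4,5) by simp
    qed (use x y in simp_all)
    then show False using ne by simp
  qed
  \<comment> \<open>The signed distance to \<open>c\<close>. At \<open>c\<close> itself the value
    \<open>T c c\<close> is arbitrary, but the distance is 0 with either sign.\<close>
  define \<pi> where "\<pi> x = (if T x c then int (d x c) else - int (d x c))" for x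
  have "\<bar>\<pi> x - \<pi> y\<bar> \<le> int (d x y + 2 * R) \<and> int (d x y) \<le> \<bar>\<pi> x - \<pi> y\<bar> + int (2 * R)"
    if xy: "x \<in> X" "y \<in> X" for x y
  proof (cases "T x c = T y c")
    case True
    have "\<bar>\<pi> x - \<pi> y\<bar> = \<bar>int (d x c) - int (d y c)\<bar>" using True by (auto simp: \<pi>_def)
    then show ?thesis using same[OF xy True] tri[OF xy c] tri[OF xy(2,1) c] com[OF xy] by linarith
  next
    case False
    have "\<bar>\<pi> x - \<pi> y\<bar> = int (d x c) + int (d y c)" using False by (auto simp: \<pi>_def)
    then show ?thesis
      using opposite[OF xy False] tri[OF xy(1) c xy(2)] com[OF c xy(2)] by linarith
  qed
  then show ?thesis by (intro exI[of _ \<pi>]) simp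
qed

text \<open>Ties in the height are broken by an arbitrary well-order.\<close>

lemma linear_order_with_height:
  fixes h :: "'a \<Rightarrow> int"
  shows "\<exists>r. linear_order_on X r \<and> (\<forall>(x, y)\<in>r. h x \<le> h y)"
proof -
  obtain w where "well_order_on X w" using well_order_on by blast
  then have w: "linear_order_on X w" unfolding well_order_on_def by simp
  define r where "r = {(x, y). x \<in> X \<and> y \<in> X \<and> (h x < h y \<or> h x = h y \<and> (x, y) \<in> w)}"
  have "linear_order_on X r"
  proof (rule linear_order_onI)
    show "r \<subseteq> X \<times> X" by (auto simp: r_def)
    show "(x, x) \<in> r" if "x \<in> X" for x using that linear_order_onD(1)[OF w] by (simp add: r_def)
    show "(x, z) \<in> r" if "(x, y) \<in> r" "(y, z) \<in> r" for x y z
      using that linear_order_onD(2)[OF w, of x y z] by (auto simp: r_def)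
    show "x = y" if "(x, y) \<in> r" "(y, x) \<in> r" for x y
      using that linear_order_onD(3)[OF w, of x y] by (auto simp: r_def)
    show "(x, y) \<in> r \<or> (y, x) \<in> r" if "x \<in> X" "y \<in> X" "x \<noteq> y" for x y
      using that linear_order_onD(4)[OF w, of x y] by (auto simp: r_def)
  qed
  then show ?thesis by (intro exI[of _ r]) (auto simp: r_def)
qed

section \<open>Interval orders on countable locally finite groups\<close>

context group
begin

text \<open>The balls of a finitary entourage are finite, so a cofinal sequence of entourages with
  convex balls is already an interval base.\<close>

lemma finitary_interval_coarseI:
  assumes r: "linear_order_on (carrier G) r"
    and B: "\<And>n :: nat. B n \<in> finitary_coarse G"
    and cofinal: "\<And>F. finite F \<Longrightarrow> F \<subseteq> carrier G \<Longrightarrow>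
      \<exists>n. \<forall>x\<in>carrier G. \<forall>y\<in>carrier G. x \<otimes> inv y \<in> F \<longrightarrow> (x, y) \<in> B n"
    and convex: "\<And>n x a z b. (x, a) \<in> B n \<Longrightarrow> (x, b) \<in> B n \<Longrightarrow> (a, z) \<in> r \<Longrightarrow> (z, b) \<in> r \<Longrightarrow>
      (x, z) \<in> B n"
  shows "interval_coarse (carrier G) (finitary_coarse G) r"
proof -
  have "\<exists>n. E \<subseteq> B n" if E: "E \<in> finitary_coarse G" for E
  proof -
    obtain F where F: "finite F" "F \<subseteq> carrier G"
        "\<forall>(x, y)\<in>E. x \<in> carrier G \<and> y \<in> carrier G \<and> x \<otimes> inv y \<in> F"
      using finitary_coarse_iff[THEN iffD1, OF E] by (elim conjE exE)
    obtain n where "\<forall>x\<in>carrier G. \<forall>y\<in>carrier G. x \<otimes> inv y \<in> F \<longrightarrow> (x, y) \<in> B n"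
      using cofinal[OF F(1,2)] by (elim exE)
    then have "E \<subseteq> B n" using F(3) by (intro subrelI) auto
    then show ?thesis by (rule exI)
  qed
  then have "coarse_base (range B) (finitary_coarse G)"
    using B unfolding coarse_base_def by auto
  moreover have "interval_entourage (carrier G) r (B n)" for n
    unfolding interval_entourage_def
  proof
    fix x assume x: "x \<in> carrier G"
    have Id: "Id_on (carrier G) \<subseteq> B n" using finitary_coarse_iff[THEN iffD1, OF B[of n]] by (elim conjE)
    obtain F where F: "finite F" "F \<subseteq> carrier G"
        "\<forall>(x, y)\<in>B n. x \<in> carrier G \<and> y \<in> carrier G \<and> x \<otimes> inv y \<in> F"
      using finitary_coarse_iff[THEN iffD1, OF B[of n]] by (elim conjE exE)
    have sub: "B n `` {x} \<subseteq> (\<lambda>f. inv f \<otimes> x) ` F"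
    proof
      fix y assume "y \<in> B n `` {x}"
      then have y: "y \<in> carrier G" "x \<otimes> inv y \<in> F" using F(3) by auto
      have "y = inv (x \<otimes> inv y) \<otimes> x" using x y(1) by (simp add: inv_mult_group m_assoc)
      then show "y \<in> (\<lambda>f. inv f \<otimes> x) ` F" using y(2) by (rule image_eqI)
    qed
    show "\<exists>a\<in>carrier G. \<exists>b\<in>carrier G. (a, x) \<in> r \<and> (x, b) \<in> r \<and>
        B n `` {x} = {z \<in> carrier G. (a, z) \<in> r \<and> (z, b) \<in> r}"
    proof (rule finite_convex_interval[OF r])
      show "finite (B n `` {x})" using sub F(1) by (rule finite_subset[OF _ finite_imageI])
      show "B n `` {x} \<subseteq> carrier G" using F(3) by auto
      show "x \<in> B n `` {x}" using Id x by auto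
      show "z \<in> B n `` {x}" if "a \<in> B n `` {x}" "b \<in> B n `` {x}" "(a, z) \<in> r" "(z, b) \<in> r" for a z b
        using convex[of x a n b z] that by simp
    qed
  qed
  ultimately show ?thesis unfolding interval_coarse_def by (intro exI[of _ "range B"]) auto
qed

lemma countable_locally_finite_interval:
  assumes count: "countable (carrier G)"
    and lf: "\<And>S. finite S \<Longrightarrow> S \<subseteq> carrier G \<Longrightarrow> finite (generate G S)"
  shows "\<exists>r. linear_order_on (carrier G) r \<and> interval_coarse (carrier G) (finitary_coarse G) r"
proof -
  \<comment> \<open>For a finite carrier the enumeration repeats elements: it is onto but perhaps
    not injective.\<close>
  define e where "e = from_nat_into (carrier G)"
  have e: "range e = carrier G" unfolding e_def
    using count by (intro range_from_nat_into) auto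
  \<comment> \<open>An increasing chain of finite subgroups exhausting the group. It starts with the
    trivial subgroup, which makes the labels at level 0 injective.\<close>
  define H where "H n = generate G (e ` {..<n})" for n
  have eG: "e ` {..<n} \<subseteq> carrier G" for n using e by auto
  have HG: "H n \<subseteq> carrier G" for n unfolding H_def by (rule generate_incl[OF eG])
  have Hmult: "g \<otimes> h \<in> H n" and Hinv: "inv g \<in> H n" if "g \<in> H n" "h \<in> H n" for g h n
    using that generate.eng generate_m_inv_closed[OF eG] unfolding H_def by auto
  have Hone: "\<one> \<in> H n" for n unfolding H_def by (rule generate.one)
  have Hmono: "H m \<subseteq> H n" if "m \<le> n" for m n
    unfolding H_def using that by (intro mono_generate) auto
  have Hcof: "\<exists>n. F \<subseteq> H n" if F: "finite F" "F \<subseteq> carrier G" for F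
  proof -
    obtain N where N: "finite N" "F = e ` N"
      using finite_subset_image[OF F(1), of e UNIV] F(2) e by auto
    obtain n where "N \<subseteq> {..<n}" using N(1) finite_nat_bounded by blast
    then have "F \<subseteq> H n" unfolding H_def N(2) by (auto intro: generate.incl)
    then show ?thesis by (rule exI)
  qed
  \<comment> \<open>The label of the right coset of \<open>H n\<close> through \<open>x\<close>: the
    first index at which the enumeration meets that coset.\<close>
  define c where "c n x = (LEAST k. e k \<otimes> inv x \<in> H n)" for n x
  have c_in: "e (c n x) \<otimes> inv x \<in> H n" if x: "x \<in> carrier G" for n x
  proof -
    obtain k where "e k = x" using x e by (metis imageE)
    then have "e k \<otimes> inv x \<in> H n" using x Hone by simp
    then show ?thesis unfolding c_def by (rule LeastI)
  qed
  have c_eq: "c n x = c n y \<longleftrightarrow> x \<otimes> inv y \<in> H n" if xy: "x \<in> carrier G" "y \<in> carrier G" for n x y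
  proof
    assume eq: "c n x = c n y"
    let ?k = "e (c n x)"
    have k: "?k \<in> carrier G" using e by auto
    have "inv (?k \<otimes> inv x) \<otimes> (?k \<otimes> inv y) \<in> H n"
      using c_in[OF xy(1), of n] c_in[OF xy(2), of n] Hmult Hinv unfolding eq by simp
    moreover have "inv (?k \<otimes> inv x) \<otimes> (?k \<otimes> inv y) = x \<otimes> inv y"
      using xy k by (simp add: inv_mult_group m_assoc) (simp flip: m_assoc)
    ultimately show "x \<otimes> inv y \<in> H n" by simp
  next
    assume xyH: "x \<otimes> inv y \<in> H n"
    have "e k \<otimes> inv x \<in> H n \<longleftrightarrow> e k \<otimes> inv y \<in> H n" for k
    proof
      have k: "e k \<in> carrier G" using e by auto
      show "e k \<otimes> inv y \<in> H n" if "e k \<otimes> inv x \<in> H n"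
      proof -
        have "(e k \<otimes> inv x) \<otimes> (x \<otimes> inv y) = e k \<otimes> inv y"
          using xy k by (simp add: m_assoc) (simp flip: m_assoc)
        then show ?thesis using Hmult[OF that xyH] by simp
      qed
      show "e k \<otimes> inv x \<in> H n" if "e k \<otimes> inv y \<in> H n"
      proof -
        have "(e k \<otimes> inv y) \<otimes> inv (x \<otimes> inv y) = e k \<otimes> inv x"
          using xy k by (simp add: m_assoc inv_mult_group) (simp flip: m_assoc)
        then show ?thesis using Hmult[OF that Hinv[OF xyH xyH]] by simp
      qed
    qed
    then show "c n x = c n y" unfolding c_def by simp
  qed
  have H0: "H 0 = {\<one>}" unfolding H_def by (simp add: generate_empty)
  have c_inj: "x = y" if "x \<in> carrier G" "y \<in> carrier G" "c 0 x = c 0 y" for x y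
  proof -
    have "x \<otimes> inv y = \<one>" using c_eq[OF that(1,2)] that(3) H0 by simp
    then have "inv (inv y) = x" using that by (intro inv_equality) simp_all
    then show ?thesis using that by simp
  qed
  have c_mono: "\<forall>m\<ge>n. c m x = c m y" if "x \<in> carrier G" "y \<in> carrier G" "c n x = c n y" for n x y
    using that c_eq[OF that(1,2)] Hmono by auto
  have c_ev: "\<exists>n. \<forall>m\<ge>n. c m x = c m y" if "x \<in> carrier G" "y \<in> carrier G" for x y
  proof -
    obtain n where "{x \<otimes> inv y} \<subseteq> H n" using Hcof[of "{x \<otimes> inv y}"] \<open>x \<in> carrier G\<close> \<open>y \<in> carrier G\<close> by auto
    then show ?thesis using c_mono[OF that] c_eq[OF that] by auto
  qed
  define r where "r = {(x, y). x \<in> carrier G \<and> y \<in> carrier G \<and>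
    (x = y \<or> (\<exists>n. c n x < c n y \<and> (\<forall>m>n. c m x = c m y)))}"
  have r: "linear_order_on (carrier G) r"
    by (rule colex_order(1)[OF _ _ r_def]) (fact c_inj, fact c_ev)
  have r_convex: "c n z = c n a" if "(a, z) \<in> r" "(z, b) \<in> r" "\<forall>m\<ge>n. c m a = c m b" for a z b n
    by (rule colex_order(2)[OF _ _ r_def that]) (fact c_inj, fact c_ev)
  \<comment> \<open>The balls are the right cosets of \<open>H n\<close>, that is, the level sets of
    \<open>c n\<close>.\<close>
  define B where "B n = {(x, y). x \<in> carrier G \<and> y \<in> carrier G \<and> x \<otimes> inv y \<in> H n}" for n
  have "interval_coarse (carrier G) (finitary_coarse G) r"
  proof (rule finitary_interval_coarseI[OF r])
    show "B n \<in> finitary_coarse G" for n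
    proof -
      have "Id_on (carrier G) \<subseteq> B n" using Hone by (auto simp: B_def)
      moreover have "finite (H n)" unfolding H_def by (intro lf eG) simp
      ultimately show ?thesis unfolding finitary_coarse_iff
        using HG[of n] by (intro conjI exI[of _ "H n"]) (auto simp: B_def)
    qed
    show "\<exists>n. \<forall>x\<in>carrier G. \<forall>y\<in>carrier G. x \<otimes> inv y \<in> F \<longrightarrow> (x, y) \<in> B n"
      if "finite F" "F \<subseteq> carrier G" for F
      using Hcof[OF that] unfolding B_def by auto
    show "(x, z) \<in> B n" if "(x, a) \<in> B n" "(x, b) \<in> B n" "(a, z) \<in> r" "(z, b) \<in> r" for n x a z b
    proof -
      have X: "x \<in> carrier G" "a \<in> carrier G" "b \<in> carrier G" "z \<in> carrier G"
        using that by (auto simp: B_def r_def)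
      have eq: "c n x = c n a" "c n x = c n b" using that(1,2) c_eq X by (simp_all add: B_def)
      have "c n z = c n a" by (rule r_convex[OF that(3,4)], rule c_mono) (use X eq in simp_all)
      then have "c n x = c n z" using eq by simp
      then show ?thesis using c_eq X by (simp add: B_def)
    qed
  qed
  then show ?thesis using r by auto
qed

section \<open>Word balls, the word metric and finitely generated groups\<close>

primrec word_ball :: "'a set \<Rightarrow> nat \<Rightarrow> 'a set" where
  "word_ball S 0 = {\<one>}"
| "word_ball S (Suc n) = (\<lambda>(g, s). g \<otimes> s) ` (word_ball S n \<times> insert \<one> (S \<union> m_inv G ` S))"

lemma word_ball_SucI:
  "g \<in> word_ball S n \<Longrightarrow> s \<in> insert \<one> (S \<union> m_inv G ` S) \<Longrightarrow> g \<otimes> s \<in> word_ball S (Suc n)"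
  by force

lemma word_ball_SucE:
  assumes "g \<in> word_ball S (Suc n)"
  obtains h s where "h \<in> word_ball S n" "s \<in> insert \<one> (S \<union> m_inv G ` S)" "g = h \<otimes> s"
  using assms by auto

declare word_ball.simps(2) [simp del]

lemma finite_word_ball: "finite S \<Longrightarrow> finite (word_ball S n)"
  by (induction n) (simp_all add: word_ball.simps(2))

lemma countable_word_ball: "countable S \<Longrightarrow> countable (word_ball S n)"
  by (induction n) (simp_all add: word_ball.simps(2))

lemma word_ball_subset:
  assumes "S \<subseteq> carrier G"
  shows "word_ball S n \<subseteq> carrier G"
proof (induction n)
  case (Suc n)
  show ?case
  proof
    fix g assume "g \<in> word_ball S (Suc n)"
    then show "g \<in> carrier G" using Suc assms by (elim word_ball_SucE) auto
  qed
qed simp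

lemma word_ball_letter:
  assumes "S \<subseteq> carrier G" "s \<in> insert \<one> (S \<union> m_inv G ` S)"
  shows "s \<in> word_ball S 1"
proof -
  have "s \<in> carrier G" using assms by auto
  then show ?thesis using word_ball_SucI[of \<one> S 0 s] assms(2) by simp
qed

lemma word_ball_mult:
  assumes S: "S \<subseteq> carrier G" and "g \<in> word_ball S m" "h \<in> word_ball S n"
  shows "g \<otimes> h \<in> word_ball S (m + n)"
  using assms(3)
proof (induction n arbitrary: h)
  case 0
  then show ?case using assms(2) word_ball_subset[OF S, of m] by auto
next
  case (Suc n)
  from Suc.prems obtain h' s where h: "h' \<in> word_ball S n" "s \<in> insert \<one> (S \<union> m_inv G ` S)" "h = h' \<otimes> s"
    by (rule word_ball_SucE)
  have "g \<in> carrier G" "h' \<in> carrier G" "s \<in> carrier G"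
    using assms(2) h(1,2) S word_ball_subset[OF S] by auto
  then have "g \<otimes> h = (g \<otimes> h') \<otimes> s" using h(3) by (simp add: m_assoc)
  then show ?case using word_ball_SucI[OF Suc.IH[OF h(1)] h(2)] by simp
qed

text \<open>With \<open>\<one>\<close> among the letters, a short word can be padded to any greater
  length.\<close>

lemma word_ball_mono:
  assumes "S \<subseteq> carrier G" "m \<le> n"
  shows "word_ball S m \<subseteq> word_ball S n"
proof
  fix g assume g: "g \<in> word_ball S m"
  have one: "\<one> \<in> word_ball S k" for k
    by (induction k) (use word_ball_SucI[of \<one> S _ \<one>] in simp_all)
  have "g \<otimes> \<one> \<in> word_ball S (m + (n - m))" by (rule word_ball_mult[OF assms(1) g one])
  then show "g \<in> word_ball S n" using g word_ball_subset[OF assms(1), of m] assms(2) by auto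
qed

lemma word_ball_inv:
  assumes S: "S \<subseteq> carrier G" and "g \<in> word_ball S n"
  shows "inv g \<in> word_ball S n"
  using assms(2)
proof (induction n arbitrary: g)
  case (Suc n)
  from Suc.prems obtain h s where h: "h \<in> word_ball S n" "s \<in> insert \<one> (S \<union> m_inv G ` S)" "g = h \<otimes> s"
    by (rule word_ball_SucE)
  have c: "h \<in> carrier G" "s \<in> carrier G" using h(1,2) S word_ball_subset[OF S] by auto
  have "inv s \<in> insert \<one> (S \<union> m_inv G ` S)" using h(2) S by auto
  \<comment> \<open>Inversion reverses the word, so the letter stands on the left and cannot simply
    be appended; balls of radius 1 and \<open>n\<close> are multiplied instead.\<close>
  then have "inv s \<otimes> inv h \<in> word_ball S (1 + n)"
    by (intro word_ball_mult[OF S] word_ball_letter[OF S] Suc.IH[OF h(1)])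
  then show ?case using c h(3) by (simp add: inv_mult_group)
qed simp

lemma generate_eq_word_ball:
  assumes S: "S \<subseteq> carrier G"
  shows "generate G S = (\<Union>n. word_ball S n)"
proof
  show "generate G S \<subseteq> (\<Union>n. word_ball S n)"
  proof
    fix g assume "g \<in> generate G S"
    then have "\<exists>n. g \<in> word_ball S n"
    proof (induction rule: generate.induct)
      case one
      show ?case by (intro exI[of _ 0]) simp
    next
      case (incl h)
      then show ?case by (intro exI[of _ 1] word_ball_letter[OF S]) simp
    next
      case (inv h)
      then show ?case by (intro exI[of _ 1] word_ball_letter[OF S]) simp
    next
      case (eng g h)
      then obtain m n where "g \<in> word_ball S m" "h \<in> word_ball S n" by (elim exE)
      from word_ball_mult[OF S this] show ?case by (rule exI)
    qed
    then show "g \<in> (\<Union>n. word_ball S n)" by simp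
  qed
  have "g \<in> generate G S" if "g \<in> word_ball S n" for g n
    using that
  proof (induction n arbitrary: g)
    case 0
    then show ?case by (simp add: generate.one)
  next
    case (Suc n)
    from Suc.prems obtain h s where h: "h \<in> word_ball S n" "s \<in> insert \<one> (S \<union> m_inv G ` S)" "g = h \<otimes> s"
      by (rule word_ball_SucE)
    have "s \<in> generate G S" using h(2) by (auto intro: generate.intros)
    then show ?case using Suc.IH[OF h(1)] h(3) by (simp add: generate.eng)
  qed
  then show "(\<Union>n. word_ball S n) \<subseteq> generate G S" by auto
qed

text \<open>Cofinality of the balls among finite sets: this is what lets the word metric describe
  the finitary coarse structure.\<close>

lemma finite_subset_word_ball:
  assumes S: "S \<subseteq> carrier G" "generate G S = carrier G" and "finite F" "F \<subseteq> carrier G"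
  shows "\<exists>n. F \<subseteq> word_ball S n"
  using assms(3,4)
proof (induction F rule: finite_induct)
  case empty
  show ?case by simp
next
  case (insert g F)
  then obtain n where n: "F \<subseteq> word_ball S n" by auto
  obtain m where m: "g \<in> word_ball S m"
    using insert.prems S(2) unfolding generate_eq_word_ball[OF S(1)] by auto
  have "insert g F \<subseteq> word_ball S (max m n)"
    using n m word_ball_mono[OF S(1), of m "max m n"] word_ball_mono[OF S(1), of n "max m n"] by auto
  then show ?case by (rule exI)
qed

text \<open>The distance is \<open>word_length S (x \<otimes> inv y)\<close>, since the entourages are invariant under
  right translations.\<close>

definition word_length :: "'a set \<Rightarrow> 'a \<Rightarrow> nat" where
  "word_length S g = (LEAST n. g \<in> word_ball S n)"

lemma word_length_le_iff:
  assumes S: "S \<subseteq> carrier G" "generate G S = carrier G" and g: "g \<in> carrier G"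
  shows "word_length S g \<le> n \<longleftrightarrow> g \<in> word_ball S n"
proof
  have "\<exists>n. g \<in> word_ball S n" using g S generate_eq_word_ball by auto
  then have "g \<in> word_ball S (word_length S g)" unfolding word_length_def by (rule LeastI_ex)
  then show "g \<in> word_ball S n" if "word_length S g \<le> n"
    using word_ball_mono[OF S(1) that] by auto
  show "word_length S g \<le> n" if "g \<in> word_ball S n"
    unfolding word_length_def using that by (rule Least_le)
qed

text \<open>The word metric satisfies the hypotheses of \<open>tournament_quasi_line\<close>. The
  resulting height \<open>\<pi>\<close> agrees with the metric up to \<open>2 * R\<close>, so
  bounded height differences define a base, and its balls are convex for any order along which
  \<open>\<pi>\<close> is monotone.\<close>

lemma finitely_generated_interval:
  assumes T: "coarse_tournament T" and S: "finite S" "S \<subseteq> carrier G" "generate G S = carrier G"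
  shows "\<exists>r. linear_order_on (carrier G) r \<and> interval_coarse (carrier G) (finitary_coarse G) r"
proof -
  let ?X = "carrier G"
  define d where "d x y = word_length S (x \<otimes> inv y)" for x y
  have d_le: "d x y \<le> n \<longleftrightarrow> x \<otimes> inv y \<in> word_ball S n" if "x \<in> ?X" "y \<in> ?X" for x y n
    unfolding d_def using that by (intro word_length_le_iff S) simp
  have d_in: "x \<otimes> inv y \<in> word_ball S (d x y)" if "x \<in> ?X" "y \<in> ?X" for x y
    using d_le[OF that, of "d x y"] by simp
  have d_zero: "d x y = 0 \<longleftrightarrow> x = y" if "x \<in> ?X" "y \<in> ?X" for x y
  proof -
    have "d x y = 0 \<longleftrightarrow> x \<otimes> inv y = \<one>" using d_le[OF that, of 0] by simp
    also have "\<dots> \<longleftrightarrow> x = y" using that inv_equality[of x "inv y"] by auto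
    finally show ?thesis .
  qed
  have d_sym_le: "d x y \<le> d y x" if "x \<in> ?X" "y \<in> ?X" for x y
  proof -
    have "inv (y \<otimes> inv x) \<in> word_ball S (d y x)" by (intro word_ball_inv S d_in that)
    then show ?thesis using that d_le by (simp add: inv_mult_group)
  qed
  have d_sym: "d x y = d y x" if "x \<in> ?X" "y \<in> ?X" for x y
    using d_sym_le that by (simp add: antisym)
  have d_tri: "d x z \<le> d x y + d y z" if "x \<in> ?X" "y \<in> ?X" "z \<in> ?X" for x y z
  proof -
    have "(x \<otimes> inv y) \<otimes> (y \<otimes> inv z) \<in> word_ball S (d x y + d y z)"
      by (intro word_ball_mult S d_in that)
    moreover have "(x \<otimes> inv y) \<otimes> (y \<otimes> inv z) = x \<otimes> inv z"
      using that by (simp add: m_assoc) (simp flip: m_assoc)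
    ultimately show ?thesis using d_le that by simp
  qed
  have d_geo: "\<exists>z\<in>?X. d x z = n \<and> d z y = 1" if xy: "x \<in> ?X" "y \<in> ?X" "d x y = Suc n" for x y n
  proof -
    have "x \<otimes> inv y \<in> word_ball S (Suc n)" using d_in[OF xy(1,2)] xy(3) by simp
    then obtain h s where h: "h \<in> word_ball S n" "s \<in> insert \<one> (S \<union> m_inv G ` S)"
        "x \<otimes> inv y = h \<otimes> s"
      by (rule word_ball_SucE)
    have c: "h \<in> ?X" "s \<in> ?X" using h(1,2) S word_ball_subset[OF S(2)] by auto
    \<comment> \<open>Splitting off the last letter of \<open>x \<otimes> inv y\<close> gives the
      geodesic point \<open>s \<otimes> y\<close>. Its distances to \<open>x\<close> and
      \<open>y\<close> are at most \<open>n\<close> and 1, and the triangle inequality makes both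
      equalities.\<close>
    have x: "x = h \<otimes> (s \<otimes> y)" using xy c h(3) by (metis inv_solve_right m_assoc m_closed)
    have "x \<otimes> inv (s \<otimes> y) = h" unfolding x using xy(2) c by (simp add: m_assoc)
    then have 1: "d x (s \<otimes> y) \<le> n" using d_le[of x "s \<otimes> y" n] xy c h(1) by simp
    have "(s \<otimes> y) \<otimes> inv y = s" using xy(2) c by (simp add: m_assoc)
    then have 2: "d (s \<otimes> y) y \<le> 1"
      using d_le[of "s \<otimes> y" y 1] xy c word_ball_letter[OF S(2) h(2)] by simp
    have "d x y \<le> d x (s \<otimes> y) + d (s \<otimes> y) y" using xy c by (intro d_tri) simp_all
    then have "d x (s \<otimes> y) = n \<and> d (s \<otimes> y) y = 1" using 1 2 xy(3) by linarith
    then show ?thesis using xy(2) c by (intro bexI[of _ "s \<otimes> y"]) simp_all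
  qed
  \<comment> \<open>Left multiplication by elements of \<open>word_ball S 1\<close> gives exactly
    the moves of length at most 1; \<open>R\<close> is then a radius whose ball contains the
    exceptional set.\<close>
  obtain K where K: "finite K" "K \<subseteq> ?X"
      "\<forall>x\<in>?X. \<forall>y\<in>?X. y \<otimes> inv x \<notin> K \<longrightarrow>
         (\<forall>a\<in>word_ball S 1. \<forall>b\<in>word_ball S 1. T (a \<otimes> x) (b \<otimes> y) = T x y)"
    by (rule coarse_tournamentE[OF T finite_word_ball[OF S(1)] word_ball_subset[OF S(2)]], rule that)
  obtain R where R: "K \<subseteq> word_ball S R" using finite_subset_word_ball[OF S(2,3) K(1,2)] by (elim exE)
  have move: "T x' y' = T x y"
    if X: "x \<in> ?X" "x' \<in> ?X" "y \<in> ?X" "y' \<in> ?X" and "d x y > R" "d x x' \<le> 1" "d y y' \<le> 1"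
    for x x' y y'
  proof -
    have "y \<otimes> inv x \<notin> word_ball S R"
      using d_le[OF X(3,1), of R] d_sym[OF X(1,3)] \<open>d x y > R\<close> by simp
    then have "y \<otimes> inv x \<notin> K" using R by auto
    moreover have "x' \<otimes> inv x \<in> word_ball S 1" "y' \<otimes> inv y \<in> word_ball S 1"
      using d_le[OF X(2,1)] d_le[OF X(4,3)] d_sym[OF X(1,2)] d_sym[OF X(3,4)] that(6,7) by simp_all
    ultimately have "T ((x' \<otimes> inv x) \<otimes> x) ((y' \<otimes> inv y) \<otimes> y) = T x y"
      by (intro K(3)[rule_format] X)
    then show ?thesis using X by (simp add: m_assoc)
  qed
  have "\<exists>\<pi> :: 'a \<Rightarrow> int. \<forall>x\<in>?X. \<forall>y\<in>?X.
      \<bar>\<pi> x - \<pi> y\<bar> \<le> int (d x y + 2 * R) \<and> int (d x y) \<le> \<bar>\<pi> x - \<pi> y\<bar> + int (2 * R)"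
    by (rule tournament_quasi_line[OF one_closed, of d T R])
      (fact d_zero, fact d_sym, fact d_tri, fact d_geo, fact coarse_tournament_antisym[OF T], fact move)
  then obtain \<pi> :: "'a \<Rightarrow> int" where \<pi>: "\<forall>x\<in>?X. \<forall>y\<in>?X.
      \<bar>\<pi> x - \<pi> y\<bar> \<le> int (d x y + 2 * R) \<and> int (d x y) \<le> \<bar>\<pi> x - \<pi> y\<bar> + int (2 * R)"
    by (elim exE)
  obtain r where r: "linear_order_on ?X r" "\<forall>(x, y)\<in>r. \<pi> x \<le> \<pi> y"
    using linear_order_with_height[of ?X \<pi>] by (elim exE conjE)
  define B where "B n = {(x, y). x \<in> ?X \<and> y \<in> ?X \<and> \<bar>\<pi> x - \<pi> y\<bar> \<le> int n}" for n
  have "interval_coarse ?X (finitary_coarse G) r"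
  proof (rule finitary_interval_coarseI[OF r(1)])
    show "B n \<in> finitary_coarse G" for n
    proof -
      have "Id_on ?X \<subseteq> B n" by (auto simp: B_def)
      moreover have "x \<otimes> inv y \<in> word_ball S (n + 2 * R)" if "(x, y) \<in> B n" for x y
      proof -
        have xy: "x \<in> ?X" "y \<in> ?X" "\<bar>\<pi> x - \<pi> y\<bar> \<le> int n" using that by (auto simp: B_def)
        then have "int (d x y) \<le> \<bar>\<pi> x - \<pi> y\<bar> + int (2 * R)" using \<pi> by simp
        then have "d x y \<le> n + 2 * R" using xy(3) by linarith
        then show ?thesis using d_le xy by simp
      qed
      ultimately show ?thesis
        unfolding finitary_coarse_iff
        using finite_word_ball[OF S(1)] word_ball_subset[OF S(2)]
        by (intro conjI exI[of _ "word_ball S (n + 2 * R)"]) (auto simp: B_def)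
    qed
    show "\<exists>n. \<forall>x\<in>?X. \<forall>y\<in>?X. x \<otimes> inv y \<in> F \<longrightarrow> (x, y) \<in> B n"
      if F: "finite F" "F \<subseteq> ?X" for F
    proof -
      obtain m where m: "F \<subseteq> word_ball S m" using finite_subset_word_ball[OF S(2,3) F] by (elim exE)
      have "(x, y) \<in> B (m + 2 * R)" if xy: "x \<in> ?X" "y \<in> ?X" "x \<otimes> inv y \<in> F" for x y
      proof -
        have "d x y \<le> m" using d_le[OF xy(1,2)] xy(3) m by auto
        moreover have "\<bar>\<pi> x - \<pi> y\<bar> \<le> int (d x y + 2 * R)" using \<pi> xy by simp
        ultimately show ?thesis using xy by (simp add: B_def)
      qed
      then show ?thesis by (intro exI[of _ "m + 2 * R"]) simp
    qed
    show "(x, z) \<in> B n" if "(x, a) \<in> B n" "(x, b) \<in> B n" "(a, z) \<in> r" "(z, b) \<in> r" for n x a z b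
    proof -
      \<comment> \<open>The height of \<open>z\<close> lies between two heights that are within
        \<open>n\<close> of \<open>\<pi> x\<close>.\<close>
      have "\<pi> a \<le> \<pi> z" "\<pi> z \<le> \<pi> b" using r(2) that(3,4) by auto
      moreover have "z \<in> ?X" using linear_order_onD(5)[OF r(1) that(3)] by simp
      ultimately show ?thesis using that(1,2) unfolding B_def by auto
    qed
  qed
  then show ?thesis using r(1) by auto
qed

text \<open>If a finite set generates an infinite subgroup, finitely many further elements generate
  the group. Otherwise the group is locally finite, and only countability remains to be
  shown.\<close>

lemma coarse_tournament_imp_interval:
  assumes T: "coarse_tournament T"
  shows "\<exists>r. linear_order_on (carrier G) r \<and> interval_coarse (carrier G) (finitary_coarse G) r"
proof (cases "\<exists>S. finite S \<and> S \<subseteq> carrier G \<and> infinite (generate G S)")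
  case True
  then obtain S where S: "finite S" "S \<subseteq> carrier G" "infinite (generate G S)" by (elim exE conjE)
  obtain K where K: "\<forall>s\<in>S. finite (K s) \<and> K s \<subseteq> carrier G"
      "carrier G = generate G (S \<union> (\<Union>s\<in>S. K s))"
    using coarse_tournament_generators[OF T S(2,3)] by (elim exE conjE)
  show ?thesis
    by (rule finitely_generated_interval[OF T, of "S \<union> (\<Union>s\<in>S. K s)"]) (use S K in auto)
next
  case False
  have "countable (carrier G)"
  proof (cases "finite (carrier G)")
    case True
    then show ?thesis by (rule countable_finite)
  next
    case inf: False
    \<comment> \<open>A countably infinite \<open>S\<close> generates an infinite subgroup, and a
      finite set of extra generators for each of its elements leaves the generating set
      countable.\<close>
    obtain S where S: "countable S" "infinite S" "S \<subseteq> carrier G"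
      using infinite_countable_subset'[OF inf] by (elim exE conjE)
    have "S \<subseteq> generate G S" by (auto intro: generate.incl)
    then have infS: "infinite (generate G S)" using S(2) finite_subset by auto
    obtain K where K: "\<forall>s\<in>S. finite (K s) \<and> K s \<subseteq> carrier G"
        "carrier G = generate G (S \<union> (\<Union>s\<in>S. K s))"
      using coarse_tournament_generators[OF T S(3) infS] by (elim exE conjE)
    let ?L = "S \<union> (\<Union>s\<in>S. K s)"
    have L: "countable ?L" "?L \<subseteq> carrier G"
      using S K(1) by (auto intro: countable_finite)
    have "countable (generate G ?L)"
      unfolding generate_eq_word_ball[OF L(2)]
      by (intro countable_UN countable_word_ball L(1)) simp
    then show ?thesis using K(2) by simp
  qed
  then show ?thesis using False by (intro countable_locally_finite_interval) auto
qed

end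

section \<open>The cycle of implications between the three statements\<close>

theorem theorem3:
  fixes G :: "('a, 'b) monoid_scheme"
  assumes "group G"
  shows "((\<exists>r. linear_order_on (carrier G) r \<and> interval_coarse (carrier G) (finitary_coarse G) r)
            \<longleftrightarrow> (\<exists>r. linear_order_on (carrier G) r \<and> compatible_order (carrier G) (finitary_coarse G) r))
       \<and> ((\<exists>r. linear_order_on (carrier G) r \<and> compatible_order (carrier G) (finitary_coarse G) r)
            \<longleftrightarrow> (\<exists>f. two_selector (carrier G) (finitary_coarse G) f))"
  (is "(?i \<longleftrightarrow> ?ii) \<and> (?ii \<longleftrightarrow> ?iii)")
proof -
  note cs = finitary_coarse(1)[OF assms]
  have "?i \<Longrightarrow> ?ii" using interval_coarse_imp_compatible_order[OF _ cs] by auto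
  moreover have "?ii \<Longrightarrow> ?iii"
    by (elim exE conjE) (rule compatible_order_imp_two_selector[OF _ cs])
  moreover have "?iii \<Longrightarrow> ?i"
    by (elim exE) (rule group.coarse_tournament_imp_interval[OF assms
          group.two_selector_imp_coarse_tournament[OF assms]])
  ultimately show ?thesis by auto
qed

end
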